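(* Let $\mathbb{U}$ be a monster model of $\operatorname{Th}(\mathcal{U})$, and let $A,B,C\subset\mathbb{U}$ be small. Then the following are equivalent: (1) $A\mathop{\smile\!\!\!\!\!\mid}^f_C B$; (2) $A\mathop{\smile\!\!\!\!\!\mid}^d_C B$; (3) for all $b_1,b_2\in B$, $$d_{\max}(b_1,b_2/AC)=d_{\max}(b_1,b_2/C)\quad\text{and}\quad d_{\min}(b_1,b_2/AC)=d_{\min}(b_1,b_2/C).$$
   Context: $\mathcal{U}$ is the Urysohn sphere (the unique complete separable metric space of diameter 1 that is ultrahomogeneous and universal for separable metric spaces of diameter $\le 1$), viewed as a continuous-logic structure in the language with only the metric $d$; $\mathbb{U}$ is a sufficiently saturated monster model of its theory, and "$A\subset\mathbb{U}$" means $A$ is a subset such that $\mathbb{U}$ is $\chi(A)^+$-saturated ($\chi$ = density character). Distance arithmetic is truncated at $1$, and $\sup\emptyset=0$, $\inf\emptyset=1$. For $b_1,b_2\in\mathbb{U}$, $C\subset\mathbb{U}$: $d_{\max}(b_1,b_2/C)=\inf_{c\in C}(d(b_1,c)+d(b_2,c))$ and $d_{\min}(b_1,b_2/C)=\max\{\sup_{c\in C}|d(b_1,c)-d(b_2,c)|,\tfrac13 d(b_1,b_2)\}$. Continuous-logic conditions have the form "$\varphi=0$"; "$\varphi\le\epsilon$" abbreviates "$\max(\varphi-\epsilon,0)=0$". A formula $\varphi(\bar x,\bar b)$ divides over $C$ if there are a sequence $(\bar b^l)_{l<\omega}$ with $\operatorname{tp}(\bar b^l/C)=\operatorname{tp}(\bar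 b/C)$ for all $l$, an $\epsilon>0$ and $k>0$ such that every $k$-element subset of $\{\varphi(\bar x,\bar b^l)\le\epsilon:l<\omega\}$ is unsatisfiable. $\varphi(\bar x,\bar b)$ forks over $C$ if there are formulas $\psi_1(\bar x,\bar b_1),\dots,\psi_m(\bar x,\bar b_m)$, each dividing over $C$, such that every realization of $\varphi(\bar x,\bar b)=0$ satisfies $\min_i\psi_i(\bar x,\bar b_i)=0$. A partial type divides (forks) over $C$ if some formula $\varphi(\bar x,\bar b)$ that divides (forks) over $C$ has $\varphi(\bar x,\bar b)=0$ at every realization of the type. $A\mathop{\smile\!\!\!\!\!\mid}^d_C B$ (resp. $\mathop{\smile\!\!\!\!\!\mid}^f$) means $\operatorname{tp}(A/BC)$ does not divide (resp. fork) over $C$. *)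

theory Defs
  imports "HOL-Analysis.Analysis"
begin

unbundle cardinal_syntax

section \<open>Metric structures and the Urysohn sphere\<close>

text \<open>
  Structures for the language whose only symbol is the metric \<open>d\<close>. They are given by a carrier
  set and a distance function, because the formulas and types below refer to two different models
  (the Urysohn sphere and the monster model).
\<close>

definition metric_structure :: "'u set \<Rightarrow> ('u \<Rightarrow> 'u \<Rightarrow> real) \<Rightarrow> bool" where
  "metric_structure M d \<longleftrightarrow>
     Metric_space M d \<and> Metric_space.mcomplete M d \<and> M \<noteq> {} \<and> (\<forall>x\<in>M. \<forall>y\<in>M. d x y \<le> 1)"

definition isometric_embedding ::
  "'a set \<Rightarrow> ('a \<Rightarrow> 'a \<Rightarrow> real) \<Rightarrow> 'b set \<Rightarrow> ('b \<Rightarrow> 'b \<Rightarrow> real) \<Rightarrow> ('a \<Rightarrow> 'b) \<Rightarrow> bool" where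
  "isometric_embedding X dX Y dY f \<longleftrightarrow>
     f \<in> X \<rightarrow> Y \<and> (\<forall>x\<in>X. \<forall>y\<in>X. dY (f x) (f y) = dX x y)"

definition ultrahomogeneous :: "'a set \<Rightarrow> ('a \<Rightarrow> 'a \<Rightarrow> real) \<Rightarrow> bool" where
  "ultrahomogeneous X dX \<longleftrightarrow>
     (\<forall>F f. F \<subseteq> X \<and> finite F \<and> isometric_embedding F dX X dX f \<longrightarrow>
        (\<exists>g. isometric_embedding X dX X dX g \<and> g ` X = X \<and> (\<forall>x\<in>F. g x = f x)))"

text \<open>
  HOL cannot quantify over all types inside a definition. A separable metric space has at most
  continuum many points, so up to isometry it lives on a set of reals (carrying an arbitrary
  metric, unrelated to the usual one).
\<close>

definition universal_separable :: "'a set \<Rightarrow> ('a \<Rightarrow> 'a \<Rightarrow> real) \<Rightarrow> bool" where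
  "universal_separable X dX \<longleftrightarrow>
     (\<forall>(Y :: real set) dY.
        Metric_space Y dY \<and> separable_space (Metric_space.mtopology Y dY) \<and>
        (\<forall>x\<in>Y. \<forall>y\<in>Y. dY x y \<le> 1) \<longrightarrow>
        (\<exists>f. isometric_embedding Y dY X dX f))"

definition urysohn_sphere :: "'a set \<Rightarrow> ('a \<Rightarrow> 'a \<Rightarrow> real) \<Rightarrow> bool" where
  "urysohn_sphere X dX \<longleftrightarrow>
     metric_structure X dX \<and>
     separable_space (Metric_space.mtopology X dX) \<and>
     (SUP (x, y)\<in>X \<times> X. dX x y) = 1 \<and>
     ultrahomogeneous X dX \<and>
     universal_separable X dX"


section \<open>Continuous logic\<close>

text \<open>
  The connectives are all continuous functions \<open>u : [0,1]\<^sup>n \<rightarrow> [0,1]\<close> for all \<open>n\<close>. A point of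
  \<open>[0,1]\<^sup>n\<close> is encoded as a sequence of reals vanishing from index \<open>n\<close> on; continuity refers to the
  product topology on sequences, which induces the usual topology on this copy of \<open>[0,1]\<^sup>n\<close>.
\<close>

datatype 'v fm =
    FDist 'v 'v
  | FConn "(nat \<Rightarrow> real) \<Rightarrow> real" "'v fm list"
  | FSup 'v "'v fm"
  | FInf 'v "'v fm"

definition unit_cube :: "nat \<Rightarrow> (nat \<Rightarrow> real) set" where
  "unit_cube n = {x. \<forall>i. (i < n \<longrightarrow> x i \<in> {0..1}) \<and> (n \<le> i \<longrightarrow> x i = 0)}"

primrec wf_fm :: "'v fm \<Rightarrow> bool" where
  "wf_fm (FDist x y) = True"
| "wf_fm (FConn u \<phi>s) =
     (continuous_on (unit_cube (length \<phi>s)) u \<and> u \<in> unit_cube (length \<phi>s) \<rightarrow> {0..1} \<and>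
      list_all id (map wf_fm \<phi>s))"
| "wf_fm (FSup x \<phi>) = wf_fm \<phi>"
| "wf_fm (FInf x \<phi>) = wf_fm \<phi>"

primrec fv :: "'v fm \<Rightarrow> 'v set" where
  "fv (FDist x y) = {x, y}"
| "fv (FConn u \<phi>s) = \<Union> (set (map fv \<phi>s))"
| "fv (FSup x \<phi>) = fv \<phi> - {x}"
| "fv (FInf x \<phi>) = fv \<phi> - {x}"

primrec eval :: "'u set \<Rightarrow> ('u \<Rightarrow> 'u \<Rightarrow> real) \<Rightarrow> 'v fm \<Rightarrow> ('v \<Rightarrow> 'u) \<Rightarrow> real" where
  "eval M d (FDist x y) = (\<lambda>\<sigma>. d (\<sigma> x) (\<sigma> y))"
| "eval M d (FConn u \<phi>s) =
     (\<lambda>\<sigma>. u (\<lambda>i. if i < length \<phi>s then (map (eval M d) \<phi>s ! i) \<sigma> else 0))"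
| "eval M d (FSup x \<phi>) = (\<lambda>\<sigma>. SUP a\<in>M. eval M d \<phi> (\<sigma>(x := a)))"
| "eval M d (FInf x \<phi>) = (\<lambda>\<sigma>. INF a\<in>M. eval M d \<phi> (\<sigma>(x := a)))"

definition Th :: "'u set \<Rightarrow> ('u \<Rightarrow> 'u \<Rightarrow> real) \<Rightarrow> nat fm set" where
  "Th M d = {\<phi>. wf_fm \<phi> \<and> fv \<phi> = {} \<and> (\<forall>\<sigma>. range \<sigma> \<subseteq> M \<longrightarrow> eval M d \<phi> \<sigma> = 0)}"

definition models :: "'u set \<Rightarrow> ('u \<Rightarrow> 'u \<Rightarrow> real) \<Rightarrow> nat fm set \<Rightarrow> bool" where
  "models M d T \<longleftrightarrow>
     metric_structure M d \<and> (\<forall>\<phi>\<in>T. \<forall>\<sigma>. range \<sigma> \<subseteq> M \<longrightarrow> eval M d \<phi> \<sigma> = 0)"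

text \<open>
  A formula \<open>\<phi>(x, b)\<close> in the variables \<open>x = (x\<^sub>i)\<^sub>i\<^sub>\<in>\<^sub>I\<close> with a finite parameter tuple \<open>b\<close> is a pair
  \<open>(\<phi>, b)\<close>: the variable \<open>Inl i\<close> stands for \<open>x\<^sub>i\<close>, and \<open>Inr n\<close> with \<open>n < length b\<close> for the entry
  \<open>b ! n\<close>. The remaining variables are available for quantification. Such a pair is also used for
  the condition \<open>\<phi>(x, b) = 0\<close>.
\<close>

type_synonym ('i, 'u) pfm = "('i + nat) fm \<times> 'u list"

definition formulas_over :: "'u set \<Rightarrow> 'i set \<Rightarrow> ('i, 'u) pfm set" where
  "formulas_over D I =
     {(\<phi>, b). wf_fm \<phi> \<and> fv \<phi> \<subseteq> Inl ` I \<union> Inr ` {..<length b} \<and> set b \<subseteq> D}"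

definition pval :: "'u set \<Rightarrow> ('u \<Rightarrow> 'u \<Rightarrow> real) \<Rightarrow> ('i, 'u) pfm \<Rightarrow> ('i \<Rightarrow> 'u) \<Rightarrow> real" where
  "pval M d = (\<lambda>(\<phi>, b) a. eval M d \<phi> (case_sum a (nth b)))"

definition realizes ::
  "'u set \<Rightarrow> ('u \<Rightarrow> 'u \<Rightarrow> real) \<Rightarrow> 'i set \<Rightarrow> ('i \<Rightarrow> 'u) \<Rightarrow> ('i, 'u) pfm set \<Rightarrow> bool" where
  "realizes M d I a p \<longleftrightarrow> a \<in> I \<rightarrow> M \<and> (\<forall>\<phi>\<in>p. pval M d \<phi> a = 0)"

text \<open>\<open>tp M d D I a\<close> is the type over \<open>D\<close> of the tuple \<open>(a i)\<^sub>i\<^sub>\<in>\<^sub>I\<close>.\<close>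

definition tp ::
  "'u set \<Rightarrow> ('u \<Rightarrow> 'u \<Rightarrow> real) \<Rightarrow> 'u set \<Rightarrow> 'i set \<Rightarrow> ('i \<Rightarrow> 'u) \<Rightarrow> ('i, 'u) pfm set" where
  "tp M d D I a = {\<phi> \<in> formulas_over D I. pval M d \<phi> a = 0}"

definition tp_list :: "'u set \<Rightarrow> ('u \<Rightarrow> 'u \<Rightarrow> real) \<Rightarrow> 'u set \<Rightarrow> 'u list \<Rightarrow> (nat, 'u) pfm set" where
  "tp_list M d D b = tp M d D {..<length b} (nth b)"


section \<open>Saturation and smallness\<close>

definition saturated :: "'u set \<Rightarrow> ('u \<Rightarrow> 'u \<Rightarrow> real) \<Rightarrow> 'k rel \<Rightarrow> bool" where
  "saturated M d \<kappa> \<longleftrightarrow>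
     (\<forall>D\<subseteq>M. |D| <o \<kappa> \<longrightarrow>
        (\<forall>(n :: nat) p. p \<subseteq> formulas_over D {..<n} \<longrightarrow>
           (\<forall>q\<subseteq>p. finite q \<longrightarrow> (\<exists>a. realizes M d {..<n} a q)) \<longrightarrow>
           (\<exists>a. realizes M d {..<n} a p)))"

definition dense_subset :: "'u set \<Rightarrow> ('u \<Rightarrow> 'u \<Rightarrow> real) \<Rightarrow> 'u set \<Rightarrow> 'u set \<Rightarrow> bool" where
  "dense_subset M d A D \<longleftrightarrow> D \<subseteq> A \<and> A \<subseteq> Metric_space.mtopology M d closure_of D"

text \<open>The least cardinality of a dense subset of \<open>A\<close>.\<close>

definition density_character :: "'u set \<Rightarrow> ('u \<Rightarrow> 'u \<Rightarrow> real) \<Rightarrow> 'u set \<Rightarrow> 'u rel" where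
  "density_character M d A =
     |SOME D. dense_subset M d A D \<and> (\<forall>E. dense_subset M d A E \<longrightarrow> |D| \<le>o |E| )|"

definition small :: "'u set \<Rightarrow> ('u \<Rightarrow> 'u \<Rightarrow> real) \<Rightarrow> 'u set \<Rightarrow> bool" where
  "small M d A \<longleftrightarrow> A \<subseteq> M \<and> saturated M d (cardSuc (density_character M d A))"

text \<open>
  ``Sufficiently saturated'' is read as \<open>\<aleph>\<^sub>1\<close>-saturated. Saturation relative to the parameter sets
  under consideration is part of \<^const>\<open>small\<close>; on its own, that would give nothing beyond
  saturation over finitely many points when those sets are finite.
\<close>

definition monster_model :: "'u set \<Rightarrow> ('u \<Rightarrow> 'u \<Rightarrow> real) \<Rightarrow> nat fm set \<Rightarrow> bool" where
  "monster_model M d T \<longleftrightarrow> models M d T \<and> saturated M d (cardSuc natLeq)"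


section \<open>Dividing and forking\<close>

text \<open>
  \<open>k\<close>-inconsistency is expressed through \<open>k\<close>-element sets of indices \<open>l\<close>. Taking \<open>k\<close>-element subsets
  of the set of conditions itself would make a constant sequence \<open>b\<^sup>l = b\<close> witness dividing
  vacuously, since that set then has a single element.
\<close>

definition divides ::
  "'u set \<Rightarrow> ('u \<Rightarrow> 'u \<Rightarrow> real) \<Rightarrow> 'u set \<Rightarrow> 'i set \<Rightarrow> ('i, 'u) pfm \<Rightarrow> bool" where
  "divides M d C I = (\<lambda>(\<phi>, b).
     \<exists>(bs :: nat \<Rightarrow> 'u list) (\<epsilon> :: real) (k :: nat). \<epsilon> > 0 \<and> k > 0 \<and>
       (\<forall>l. set (bs l) \<subseteq> M \<and> length (bs l) = length b \<and>
            tp_list M d C (bs l) = tp_list M d C b) \<and>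
       (\<forall>K. card K = k \<longrightarrow> \<not> (\<exists>a \<in> I \<rightarrow> M. \<forall>l\<in>K. pval M d (\<phi>, bs l) a \<le> \<epsilon>)))"

definition forks ::
  "'u set \<Rightarrow> ('u \<Rightarrow> 'u \<Rightarrow> real) \<Rightarrow> 'u set \<Rightarrow> 'i set \<Rightarrow> ('i, 'u) pfm \<Rightarrow> bool" where
  "forks M d C I \<phi> \<longleftrightarrow>
     (\<exists>\<Psi>. finite \<Psi> \<and> \<Psi> \<noteq> {} \<and> \<Psi> \<subseteq> formulas_over M I \<and> (\<forall>\<psi>\<in>\<Psi>. divides M d C I \<psi>) \<and>
        (\<forall>a \<in> I \<rightarrow> M. pval M d \<phi> a = 0 \<longrightarrow> (MIN \<psi>\<in>\<Psi>. pval M d \<psi> a) = 0))"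

definition type_divides ::
  "'u set \<Rightarrow> ('u \<Rightarrow> 'u \<Rightarrow> real) \<Rightarrow> 'u set \<Rightarrow> 'i set \<Rightarrow> ('i, 'u) pfm set \<Rightarrow> bool" where
  "type_divides M d C I p \<longleftrightarrow>
     (\<exists>\<phi>\<in>formulas_over M I. divides M d C I \<phi> \<and>
        (\<forall>a. realizes M d I a p \<longrightarrow> pval M d \<phi> a = 0))"

definition type_forks ::
  "'u set \<Rightarrow> ('u \<Rightarrow> 'u \<Rightarrow> real) \<Rightarrow> 'u set \<Rightarrow> 'i set \<Rightarrow> ('i, 'u) pfm set \<Rightarrow> bool" where
  "type_forks M d C I p \<longleftrightarrow>
     (\<exists>\<phi>\<in>formulas_over M I. forks M d C I \<phi> \<and>
        (\<forall>a. realizes M d I a p \<longrightarrow> pval M d \<phi> a = 0))"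

text \<open>A set \<open>A\<close> is regarded as a tuple by letting it enumerate itself.\<close>

definition dividing_independent ::
  "'u set \<Rightarrow> ('u \<Rightarrow> 'u \<Rightarrow> real) \<Rightarrow> 'u set \<Rightarrow> 'u set \<Rightarrow> 'u set \<Rightarrow> bool" where
  "dividing_independent M d A C B \<longleftrightarrow> \<not> type_divides M d C A (tp M d (B \<union> C) A (\<lambda>a. a))"

definition forking_independent ::
  "'u set \<Rightarrow> ('u \<Rightarrow> 'u \<Rightarrow> real) \<Rightarrow> 'u set \<Rightarrow> 'u set \<Rightarrow> 'u set \<Rightarrow> bool" where
  "forking_independent M d A C B \<longleftrightarrow> \<not> type_forks M d C A (tp M d (B \<union> C) A (\<lambda>a. a))"


section \<open>Maximal and minimal amalgamation distances\<close>

text \<open>Sums are truncated at 1, and \<open>inf \<emptyset> = 1\<close>, \<open>sup \<emptyset> = 0\<close>.\<close>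

definition d_max :: "('u \<Rightarrow> 'u \<Rightarrow> real) \<Rightarrow> 'u \<Rightarrow> 'u \<Rightarrow> 'u set \<Rightarrow> real" where
  "d_max d b1 b2 C = (if C = {} then 1 else INF c\<in>C. min 1 (d b1 c + d b2 c))"

definition d_min :: "('u \<Rightarrow> 'u \<Rightarrow> real) \<Rightarrow> 'u \<Rightarrow> 'u \<Rightarrow> 'u set \<Rightarrow> real" where
  "d_min d b1 b2 C =
     max (if C = {} then 0 else SUP c\<in>C. \<bar>d b1 c - d b2 c\<bar>) (d b1 b2 / 3)"

end

(* The theory of the Urysohn sphere contains approximate one-point extension properties: values t i
   prescribed at points z i that violate the Katetov inequalities by at most e are realised up to a
   multiple of e. Hence a saturated model realises every Katetov function on a small set, and the value of a formula is a
   uniformly continuous function of the distance matrix of its arguments, by back-and-forth.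

   Condition (3) says that every a in A satisfies
     d_max(x, y / C) <= d(a, x) + d(a, y)   and   |d(a, x) - d(a, y)| <= d_min(x, y / C)
   for x, y in B. If it fails for b1, b2, there are copies (b1^i, b2^i) of (b1, b2) over C with all
   cross distances d(b1^i, b2^j) equal to d_max (free amalgamation) or to d_min (with d(b1^i, b1^j) and
   d(b2^i, b2^j) equal to d(b1, b2) - d_min), and then no point has the distances of a to two of them.

   Conversely d_min is a pseudometric for which d_max is 1-Lipschitz in each argument, so (3) extends
   from B to B together with the parameters of any finitely many formulas, after moving A by
   a -> inf_e (d(a, e) + d_min(e, y / C)), e ranging over B and C. No formula psi(x, b) with a zero
   satisfying (3) for the parameters b divides: Ramsey's theorem makes the cross distances in a
   sequence of copies of b almost constant, which bounds them from below by d_min up to a small error,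
   and the zero can be amalgamated, up to that error, with k of the copies simultaneously. *)

theory Submission
  imports Defs "HOL-Library.Ramsey"
begin

section \<open>Metric structures of diameter at most one\<close>

text \<open>The third in \<open>d_min\<close> measures what distinct copies of (b1, b2) can do.
  Suppose b1 and b2 have constant cross distance m in distinct copies. The triangle inequalities
  then place the distance of two copies of b1 between d(b1, b2) - m and 2m. This interval is
  nonempty exactly if d(b1, b2) <= 3m, and the construction takes its left end. Forking and dividing
  agree because (3) survives the addition of finitely many parameters: one realization then refutes
  finitely many dividing formulas at once. Two obstacles shape the details. Smallness bounds density
  characters and not cardinalities, so tuples are first realized on dense subsets. A sequence
  witnessing dividing can be made only almost homogeneous, so prescribed distances satisfy the
  Katetov inequalities up to an error; infima shifted by that error repair them, at a cost no larger
  than the error itself.\<close>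

lemma wf_fm_foldr_FSup [simp]: "wf_fm (foldr FSup xs \<phi>) = wf_fm \<phi>"
  by (induction xs) auto

lemma fv_foldr_FSup [simp]: "fv (foldr FSup xs \<phi>) = fv \<phi> - set xs"
  by (induction xs) auto

locale unit_metric = Metric_space M d for M :: "'u set" and d +
  assumes nonempty: "M \<noteq> {}"
    and le_one: "\<And>x y. x \<in> M \<Longrightarrow> y \<in> M \<Longrightarrow> d x y \<le> 1"
begin

lemma eval_in_unit:
  assumes "wf_fm \<phi>" "\<And>x. x \<in> fv \<phi> \<Longrightarrow> \<sigma> x \<in> M"
  shows "eval M d \<phi> \<sigma> \<in> {0..1}"
  using assms
proof (induction \<phi> arbitrary: \<sigma>)
  case (FDist x y)
  then show ?case using le_one by auto
next
  case (FConn u \<phi>s)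
  have "(\<lambda>i. if i < length \<phi>s then (map (eval M d) \<phi>s ! i) \<sigma> else 0) \<in> unit_cube (length \<phi>s)"
    unfolding unit_cube_def
  proof (clarsimp, intro conjI)
    fix i assume i: "i < length \<phi>s"
    then have "\<phi>s ! i \<in> set \<phi>s" by simp
    then have "eval M d (\<phi>s ! i) \<sigma> \<in> {0..1}"
      using FConn.prems by (intro FConn.IH) (auto simp: list_all_iff)
    then show "0 \<le> eval M d (\<phi>s ! i) \<sigma>" "eval M d (\<phi>s ! i) \<sigma> \<le> 1" by auto
  qed
  then show ?case using FConn.prems by (auto simp: Pi_iff)
next
  case (FSup x \<phi>)
  have *: "eval M d \<phi> (\<sigma>(x := a)) \<in> {0..1}" if "a \<in> M" for a
    using FSup.prems that by (intro FSup.IH) auto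
  obtain a where "a \<in> M" using nonempty by blast
  then have "0 \<le> (SUP a\<in>M. eval M d \<phi> (\<sigma>(x := a)))"
    using * by (intro cSUP_upper2[where x=a]) (auto intro!: bdd_aboveI[of _ 1])
  moreover have "(SUP a\<in>M. eval M d \<phi> (\<sigma>(x := a))) \<le> 1"
    using * nonempty by (intro cSUP_least) auto
  ultimately show ?case by simp
next
  case (FInf x \<phi>)
  have *: "eval M d \<phi> (\<sigma>(x := a)) \<in> {0..1}" if "a \<in> M" for a
    using FInf.prems that by (intro FInf.IH) auto
  obtain a where "a \<in> M" using nonempty by blast
  then have "(INF a\<in>M. eval M d \<phi> (\<sigma>(x := a))) \<le> 1"
    using * by (intro cINF_lower2[where x=a]) (auto intro!: bdd_belowI[of _ 0])
  moreover have "0 \<le> (INF a\<in>M. eval M d \<phi> (\<sigma>(x := a)))"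
    using * nonempty by (intro cINF_greatest) auto
  ultimately show ?case by simp
qed

text \<open>Values are nonnegative, so a prefix of suprema expresses that a formula vanishes
  identically; this is how universal closures enter \<open>Th\<close>.\<close>

lemma all_eval_FSup_eq_0:
  fixes \<phi> :: "'v fm"
  assumes "wf_fm \<phi>"
  shows "(\<forall>\<sigma>. range \<sigma> \<subseteq> M \<longrightarrow> eval M d (FSup x \<phi>) \<sigma> = 0) \<longleftrightarrow>
         (\<forall>\<sigma>. range \<sigma> \<subseteq> M \<longrightarrow> eval M d \<phi> \<sigma> = 0)" (is "?L \<longleftrightarrow> ?R")
proof
  assume ?R
  have "eval M d \<phi> (\<sigma>(x := a)) = 0" if "range \<sigma> \<subseteq> M" "a \<in> M" for \<sigma> a
    using \<open>?R\<close> that by (auto simp: image_subset_iff)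
  then show ?L using nonempty by simp
next
  assume L: ?L
  show ?R
  proof (intro allI impI)
    fix \<sigma> :: "'v \<Rightarrow> 'u" assume \<sigma>: "range \<sigma> \<subseteq> M"
    have *: "eval M d \<phi> (\<sigma>(x := a)) \<in> {0..1}" if "a \<in> M" for a
      using assms \<sigma> that by (intro eval_in_unit) auto
    have "eval M d \<phi> \<sigma> = eval M d \<phi> (\<sigma>(x := \<sigma> x))" by simp
    also have "\<dots> \<le> (SUP a\<in>M. eval M d \<phi> (\<sigma>(x := a)))"
      using * \<sigma> by (intro cSUP_upper) (auto intro!: bdd_aboveI[of _ 1])
    also have "\<dots> = 0" using L \<sigma> by simp
    finally show "eval M d \<phi> \<sigma> = 0" using eval_in_unit[OF assms, of \<sigma>] \<sigma> by auto
  qed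
qed

lemma all_eval_foldr_FSup_eq_0:
  assumes "wf_fm \<phi>"
  shows "(\<forall>\<sigma>. range \<sigma> \<subseteq> M \<longrightarrow> eval M d (foldr FSup xs \<phi>) \<sigma> = 0) \<longleftrightarrow>
         (\<forall>\<sigma>. range \<sigma> \<subseteq> M \<longrightarrow> eval M d \<phi> \<sigma> = 0)"
  using assms by (induction xs) (simp_all add: all_eval_FSup_eq_0 del: eval.simps)

end

lemma metric_structure_unit_metric: "metric_structure M d \<Longrightarrow> unit_metric M d"
  by (simp add: metric_structure_def unit_metric_def unit_metric_axioms_def)

section \<open>Katetov functions\<close>

text \<open>An infimum of one-point extensions, cut off at 1; the inserted 1 also gives the value
  for empty \<open>E\<close>. The shift \<open>\<eta>\<close> pays for inequalities that hold only
  up to \<open>\<eta>\<close>.\<close>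

definition glue :: "real \<Rightarrow> 'e set \<Rightarrow> ('e \<Rightarrow> real) \<Rightarrow> real" where
  "glue \<eta> E F = Inf (insert 1 ((\<lambda>e. \<eta> + F e) ` E))"

context
  fixes \<eta> :: real and E :: "'e set"
  assumes \<eta>: "0 \<le> \<eta>"
begin

lemma bdd_below_glue: "(\<And>e. e \<in> E \<Longrightarrow> 0 \<le> F e) \<Longrightarrow> bdd_below (insert 1 ((\<lambda>e. \<eta> + F e) ` E))"
  using \<eta> by (intro bdd_belowI[of _ 0]) force

lemma glue_le_one: "(\<And>e. e \<in> E \<Longrightarrow> 0 \<le> F e) \<Longrightarrow> glue \<eta> E F \<le> 1"
  unfolding glue_def by (intro cInf_lower bdd_below_glue) auto

lemma glue_le: "(\<And>e. e \<in> E \<Longrightarrow> 0 \<le> F e) \<Longrightarrow> e \<in> E \<Longrightarrow> glue \<eta> E F \<le> \<eta> + F e"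
  unfolding glue_def by (intro cInf_lower bdd_below_glue) auto

lemma le_glue: "r \<le> 1 \<Longrightarrow> (\<And>e. e \<in> E \<Longrightarrow> r \<le> \<eta> + F e) \<Longrightarrow> r \<le> glue \<eta> E F"
  unfolding glue_def by (intro cInf_greatest) auto

lemma glue_le_add:
  assumes "\<And>e. e \<in> E \<Longrightarrow> 0 \<le> F e" "0 \<le> c" "\<And>e. e \<in> E \<Longrightarrow> F e \<le> G e + c"
  shows "glue \<eta> E F \<le> glue \<eta> E G + c"
proof -
  have "glue \<eta> E F - c \<le> glue \<eta> E G"
  proof (rule le_glue)
    show "glue \<eta> E F - c \<le> 1" using glue_le_one[of F] assms(1,2) by fastforce
    show "glue \<eta> E F - c \<le> \<eta> + G e" if "e \<in> E" for e
      using glue_le[of F e] assms(1) assms(3)[OF that] that by fastforce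
  qed
  then show ?thesis by simp
qed

lemma glue_nonneg: "(\<And>e. e \<in> E \<Longrightarrow> 0 \<le> F e) \<Longrightarrow> 0 \<le> glue \<eta> E F"
  using \<eta> by (intro le_glue) force+

lemma le_glue_add_glue:
  assumes "r \<le> 1" "\<And>e. e \<in> E \<Longrightarrow> 0 \<le> F e" "\<And>e. e \<in> E \<Longrightarrow> 0 \<le> G e"
    and "\<And>e e'. e \<in> E \<Longrightarrow> e' \<in> E \<Longrightarrow> r \<le> F e + G e' + 2 * \<eta>"
  shows "r \<le> glue \<eta> E F + glue \<eta> E G"
proof -
  have "r - glue \<eta> E G \<le> glue \<eta> E F"
  proof (rule le_glue)
    show "r - glue \<eta> E G \<le> 1" using assms(1) glue_nonneg[of G] assms(3) by fastforce
    fix e assume e: "e \<in> E"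
    have "r - (\<eta> + F e) \<le> glue \<eta> E G"
    proof (rule le_glue)
      show "r - (\<eta> + F e) \<le> 1" using assms(1) assms(2)[OF e] \<eta> by linarith
      show "r - (\<eta> + F e) \<le> \<eta> + G e'" if "e' \<in> E" for e'
        using assms(4)[OF e that] by linarith
    qed
    then show "r - glue \<eta> E G \<le> \<eta> + F e" by linarith
  qed
  then show ?thesis by linarith
qed

end

context unit_metric
begin

definition katetov :: "'i set \<Rightarrow> ('i \<Rightarrow> 'u) \<Rightarrow> ('i \<Rightarrow> real) \<Rightarrow> bool" where
  "katetov I z t \<longleftrightarrow> (\<forall>i\<in>I. z i \<in> M \<and> t i \<le> 1) \<and>
     (\<forall>i\<in>I. \<forall>j\<in>I. t i \<le> t j + d (z i) (z j) \<and> d (z i) (z j) \<le> t i + t j)"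

lemma katetov_nonneg: "katetov I z t \<Longrightarrow> i \<in> I \<Longrightarrow> 0 \<le> t i"
  unfolding katetov_def using nonneg by fastforce

text \<open>Indices of the same point carry the same value, by the Lipschitz inequality at distance
  0. Families may therefore repeat points.\<close>

lemma katetov_by_set:
  assumes "katetov I z t"
  shows "\<exists>s. katetov (z ` I) (\<lambda>x. x) s \<and> (\<forall>i\<in>I. s (z i) = t i)"
proof (intro exI conjI ballI)
  let ?s = "\<lambda>x. t (inv_into I z x)"
  show eq: "?s (z i) = t i" if "i \<in> I" for i
  proof -
    have j: "inv_into I z (z i) \<in> I" "z (inv_into I z (z i)) = z i"
      using that by (auto intro: inv_into_into f_inv_into_f)
    have "d (z i) (z i) = 0" using assms that unfolding katetov_def by simp
    then show ?thesis using assms j that unfolding katetov_def by (metis add.right_neutral antisym)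
  qed
  show "katetov (z ` I) (\<lambda>x. x) ?s"
    using assms unfolding katetov_def by (simp add: eq)
qed

text \<open>A function on points \<open>z i\<close> that is Katetov only up to an error \<open>\<eta>\<close> is moved by at most \<open>\<eta>\<close>
  to a genuine one, defined on the whole space.\<close>

lemma katetov_correction:
  assumes \<eta>: "0 \<le> \<eta>" and z: "\<And>i. i \<in> I \<Longrightarrow> z i \<in> M" and t: "\<And>i. i \<in> I \<Longrightarrow> 0 \<le> t i \<and> t i \<le> 1"
    and lip: "\<And>i j. i \<in> I \<Longrightarrow> j \<in> I \<Longrightarrow> t i \<le> t j + d (z i) (z j) + \<eta>"
    and sum: "\<And>i j. i \<in> I \<Longrightarrow> j \<in> I \<Longrightarrow> d (z i) (z j) \<le> t i + t j + \<eta>"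
  defines "g \<equiv> \<lambda>y. glue \<eta> I (\<lambda>i. t i + d (z i) y)"
  shows "katetov M (\<lambda>x. x) g" and "\<And>i. i \<in> I \<Longrightarrow> \<bar>g (z i) - t i\<bar> \<le> \<eta>"
proof -
  have F: "0 \<le> t i + d (z i) y" if "i \<in> I" for i y using t[OF that] by simp
  have "g x \<le> g y + d x y" if "x \<in> M" "y \<in> M" for x y
    unfolding g_def
  proof (rule glue_le_add[OF \<eta>])
    show "t i + d (z i) x \<le> t i + d (z i) y + d x y" if "i \<in> I" for i
      using triangle[of "z i" y x] z[OF that] \<open>x \<in> M\<close> \<open>y \<in> M\<close> by (simp add: commute)
  qed (use F in auto)
  \<comment> \<open>Here the shift is indispensable: it occurs in both infima and pays for the error
    in \<open>sum\<close>.\<close>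
  moreover have "d x y \<le> g x + g y" if "x \<in> M" "y \<in> M" for x y
    unfolding g_def
  proof (rule le_glue_add_glue[OF \<eta>])
    fix i j assume ij: "i \<in> I" "j \<in> I"
    have "d x y \<le> d (z i) x + d (z i) y"
      using triangle[of x "z i" y] z ij that by (simp add: commute)
    also have "d (z i) y \<le> d (z i) (z j) + d (z j) y"
      using triangle[of "z i" "z j" y] z ij that by simp
    finally show "d x y \<le> t i + d (z i) x + (t j + d (z j) y) + 2 * \<eta>"
      using sum[OF ij] \<eta> by linarith
  qed (use F that le_one in auto)
  moreover have "g x \<le> 1" for x unfolding g_def by (rule glue_le_one[OF \<eta>]) (use F in auto)
  ultimately show "katetov M (\<lambda>x. x) g" unfolding katetov_def by auto
  fix i assume i: "i \<in> I"
  have "g (z i) \<le> \<eta> + (t i + d (z i) (z i))"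
    unfolding g_def by (rule glue_le[OF \<eta>]) (use F i in auto)
  moreover have "t i \<le> g (z i)"
    unfolding g_def
  proof (rule le_glue[OF \<eta>])
    show "t i \<le> \<eta> + (t j + d (z j) (z i))" if "j \<in> I" for j
      using lip[OF i that] by (simp add: commute)
  qed (use t i in auto)
  ultimately show "\<bar>g (z i) - t i\<bar> \<le> \<eta>" using z[OF i] by simp
qed

end

text \<open>Universality embeds an abstract copy of the given points together with one new point;
  ultrahomogeneity moves the copy back onto the given points, and the new point goes along.\<close>

lemma urysohn_sphere_extension:
  assumes "urysohn_sphere X dX" "finite I" "unit_metric.katetov X dX I z t"
  shows "\<exists>y\<in>X. \<forall>i\<in>I. dX y (z i) = t i"
proof -
  interpret unit_metric X dX
    using assms(1) by (simp add: urysohn_sphere_def metric_structure_unit_metric)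
  obtain s where s: "katetov (z ` I) (\<lambda>x. x) s" "\<And>i. i \<in> I \<Longrightarrow> s (z i) = t i"
    using katetov_by_set[OF assms(3)] by blast
  define D where "D = z ` I"
  have D: "finite D" "katetov D (\<lambda>x. x) s" "D \<subseteq> X"
    using assms(2,3) s unfolding D_def katetov_def by auto
  \<comment> \<open>Where \<open>s\<close> vanishes, that point is itself the one required;
    otherwise adjoining a point keeps the metric definite.\<close>
  have "\<exists>y\<in>X. \<forall>x\<in>D. dX y x = s x"
  proof (cases "\<exists>x\<in>D. s x = 0")
    case True
    then obtain x where x: "x \<in> D" "s x = 0" by blast
    then have "dX x y = s y" if "y \<in> D" for y
      using D(2) that unfolding katetov_def
      by (smt (verit) commute)
    then show ?thesis using x D by blast
  next
    case False
    then have pos: "0 < s x" if "x \<in> D" for x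
      using that katetov_nonneg[OF D(2) that] by force
    obtain e where e: "bij_betw e {1..card D} D"
      using ex_bij_betw_nat_finite_1[OF D(1)] by blast
    \<comment> \<open>Universality speaks of metrics on sets of reals, so the elements of
      \<open>D\<close> are coded by 1, ..., \<open>card D\<close> and the new point by 0. The
      absolute values in \<open>dY\<close> keep it nonnegative on all reals, as
      \<open>Metric_space\<close> demands.\<close>
    define Y where "Y = real ` {0..card D}"
    define p where "p = (\<lambda>r::real. e (nat \<lfloor>r\<rfloor>))"
    define dY where "dY = (\<lambda>r r'. if r = r' then 0 else if r = 0 then \<bar>s (p r')\<bar>
       else if r' = 0 then \<bar>s (p r)\<bar> else dX (p r) (p r'))"
    have Yp: "\<exists>i\<in>{1..card D}. r = real i \<and> p r = e i" if r: "r \<in> Y" "r \<noteq> 0" for r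
    proof -
      obtain i where "i \<le> card D" "r = real i" using r(1) unfolding Y_def by auto
      then show ?thesis using r(2) by (intro bexI[of _ i]) (auto simp: p_def)
    qed
    have pD: "p r \<in> D" if "r \<in> Y" "r \<noteq> 0" for r
      using Yp[OF that] bij_betwE[OF e] by metis
    have pinj: "r = r'" if "r \<in> Y" "r \<noteq> 0" "r' \<in> Y" "r' \<noteq> 0" "p r = p r'" for r r'
      using Yp[OF that(1,2)] Yp[OF that(3,4)] that(5) bij_betw_imp_inj_on[OF e]
      by (metis inj_onD)
    have psurj: "\<exists>r\<in>Y. r \<noteq> 0 \<and> p r = x" if "x \<in> D" for x
    proof -
      have "x \<in> e ` {1..card D}" using \<open>x \<in> D\<close> bij_betw_imp_surj_on[OF e] by simp
      then obtain i where "i \<in> {1..card D}" "x = e i" by (rule imageE)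
      then show ?thesis by (intro bexI[of _ "real i"] conjI) (simp_all add: Y_def p_def)
    qed
    have sX: "s x \<le> 1" "s x \<le> s y + dX x y" "dX x y \<le> s x + s y" if "x \<in> D" "y \<in> D" for x y
      using D(2) that unfolding katetov_def by auto
    have dY_le: "dY r r' \<le> 1" if "r \<in> Y" "r' \<in> Y" for r r'
    proof -
      have "s (p r) \<le> 1 \<and> 0 < s (p r) \<and> p r \<in> X" if "r \<in> Y" "r \<noteq> 0" for r
        using sX(1) pos pD[OF that] D(3) by blast
      then show ?thesis using that le_one by (auto simp: dY_def abs_le_iff less_imp_le)
    qed
    have mY: "Metric_space Y dY"
    proof
      show "0 \<le> dY r r'" for r r' by (auto simp: dY_def)
      show "dY r r' = dY r' r" for r r' by (auto simp: dY_def commute)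
      show "(dY r r' = 0) = (r = r')" if "r \<in> Y" "r' \<in> Y" for r r'
      proof (cases "r = r' \<or> r = 0 \<or> r' = 0")
        case True
        then show ?thesis using that pD[THEN pos] by (force simp: dY_def)
      next
        case False
        then have "p r \<in> X" "p r' \<in> X" using pD D(3) that by auto
        then show ?thesis using False that pinj by (auto simp: dY_def)
      qed
      show "dY r r'' \<le> dY r r' + dY r' r''" if "r \<in> Y" "r' \<in> Y" "r'' \<in> Y" for r r' r''
      proof (cases "r = r' \<or> r = r'' \<or> r' = r''")
        case True
        then show ?thesis by (auto simp: dY_def)
      next
        case ne: False
        consider "r = 0" | "r' = 0" | "r'' = 0" | "r \<noteq> 0" "r' \<noteq> 0" "r'' \<noteq> 0" by blast
        then show ?thesis
        proof cases
          case 1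
          then show ?thesis using sX(2)[OF pD pD, of r'' r'] pos[OF pD, of r'] pos[OF pD, of r''] ne that
            by (auto simp: dY_def commute)
        next
          case 2
          then show ?thesis using sX(3)[OF pD pD, of r r''] pos[OF pD, of r] pos[OF pD, of r''] ne that
            by (auto simp: dY_def)
        next
          case 3
          then show ?thesis using sX(2)[OF pD pD, of r r'] pos[OF pD, of r] pos[OF pD, of r'] ne that
            by (auto simp: dY_def)
        next
          case 4
          then have "p r \<in> X" "p r' \<in> X" "p r'' \<in> X" using pD D(3) that by auto
          then show ?thesis using triangle[of "p r" "p r'" "p r''"] ne 4 by (simp add: dY_def)
        qed
      qed
    qed
    then interpret Y: Metric_space Y dY .
    have "separable_space Y.mtopology"
      unfolding separable_space_def by (metis Y.topspace_mtopology Y_def closure_of_topspace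
          countable_finite finite_atLeastAtMost finite_imageI order_refl)
    then obtain f where f: "isometric_embedding Y dY X dX f"
      using assms(1) mY dY_le unfolding urysohn_sphere_def universal_separable_def by blast
    then have fX: "f r \<in> X" and fd: "dX (f r) (f r') = dY r r'" if "r \<in> Y" "r' \<in> Y" for r r'
      using that unfolding isometric_embedding_def by auto
    have finj: "inj_on f Y"
      using fX fd Y.zero zero by (metis inj_onI)
    define h where "h = (\<lambda>x. p (inv_into Y f x))"
    have h: "h (f r) = p r" if "r \<in> Y" for r
      unfolding h_def using finj that by simp
    have "isometric_embedding (f ` (Y - {0})) dX X dX h"
    proof -
      have pX: "p r \<in> X" if "r \<in> Y" "r \<noteq> 0" for r using pD[OF that] D(3) by blast
      then have "dX (h (f r)) (h (f r')) = dX (f r) (f r')"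
        if "r \<in> Y - {0}" "r' \<in> Y - {0}" for r r'
        using that fd[of r r'] h by (simp add: dY_def)
      moreover have "h (f r) \<in> X" if "r \<in> Y - {0}" for r using that pX h by simp
      ultimately show ?thesis unfolding isometric_embedding_def by blast
    qed
    moreover have "f ` (Y - {0}) \<subseteq> X" "finite (f ` (Y - {0}))"
      using fX by (auto simp: Y_def)
    ultimately obtain k where k: "isometric_embedding X dX X dX k"
      "\<And>x. x \<in> f ` (Y - {0}) \<Longrightarrow> k x = h x"
      using assms(1) unfolding urysohn_sphere_def ultrahomogeneous_def by meson
    have 0: "0 \<in> Y" by (auto simp: Y_def)
    have "dX (k (f 0)) x = s x" if "x \<in> D" for x
    proof -
      obtain r where r: "r \<in> Y" "r \<noteq> 0" "p r = x" using psurj[OF \<open>x \<in> D\<close>] by blast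
      then have "k (f r) = x" using k(2)[of "f r"] h by auto
      then have "dX (k (f 0)) x = dX (f 0) (f r)"
        using k(1) fX 0 r unfolding isometric_embedding_def by metis
      then show ?thesis using fd 0 r pos[OF that] by (simp add: dY_def)
    qed
    moreover have "k (f 0) \<in> X" using k(1) fX[OF 0 0] unfolding isometric_embedding_def by blast
    ultimately show ?thesis by blast
  qed
  then show ?thesis using s(2) unfolding D_def by auto
qed

section \<open>The extension property of models of the theory of the Urysohn sphere\<close>

text \<open>The argument with index \<open>i * Suc n + j\<close> is the distance of the variables \<open>i\<close> and \<open>j\<close>; the
  variable \<open>n\<close> is the point to be found. The subtracted double sum, which vanishes iff \<open>t\<close> satisfies
  the Katetov inequalities, is there because no single formula fixes the distances of the other variables.\<close>

definition ext_conn :: "nat \<Rightarrow> (nat \<Rightarrow> real) \<Rightarrow> (nat \<Rightarrow> real) \<Rightarrow> real" where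
  "ext_conn n t v = min 1 (max 0 ((\<Sum>i<n. \<bar>v (i * Suc n + n) - t i\<bar>) -
     real n * (\<Sum>i<n. \<Sum>j<n. max 0 (t i - t j - v (i * Suc n + j)) +
                               max 0 (v (i * Suc n + j) - t i - t j))))"

definition ext_matrix :: "nat \<Rightarrow> nat fm list" where
  "ext_matrix n = map (\<lambda>k. FDist (k div Suc n) (k mod Suc n)) [0..<n * Suc n]"

definition ext_sentence :: "nat \<Rightarrow> (nat \<Rightarrow> real) \<Rightarrow> nat fm" where
  "ext_sentence n t = foldr FSup [0..<n] (FInf n (FConn (ext_conn n t) (ext_matrix n)))"

lemma continuous_on_ext_conn: "continuous_on S (ext_conn n t)"
  unfolding ext_conn_def
  by (intro continuous_intros continuous_on_subset[OF continuous_on_product_coordinates]) auto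

lemma wf_ext_conn: "wf_fm (FConn (ext_conn n t) (ext_matrix n))"
  using continuous_on_ext_conn[of _ n t]
  by (auto simp: list_all_iff ext_matrix_def ext_conn_def)

lemma fv_ext_sentence: "fv (ext_sentence n t) = {}"
proof -
  have "fv (FConn (ext_conn n t) (ext_matrix n)) \<subseteq> {0..n}"
    by (auto simp: ext_matrix_def less_mult_imp_div_less less_imp_le mod_less_divisor[THEN less_Suc_eq_le[THEN iffD1]])
  then show ?thesis unfolding ext_sentence_def by fastforce
qed

context unit_metric
begin

definition ext_error :: "nat \<Rightarrow> (nat \<Rightarrow> real) \<Rightarrow> (nat \<Rightarrow> 'u) \<Rightarrow> real" where
  "ext_error n t z = (\<Sum>i<n. \<Sum>j<n. max 0 (t i - t j - d (z i) (z j)) +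
                               max 0 (d (z i) (z j) - t i - t j))"

lemma eval_ext_conn:
  "eval M d (FConn (ext_conn n t) (ext_matrix n)) \<sigma> =
     min 1 (max 0 ((\<Sum>i<n. \<bar>d (\<sigma> i) (\<sigma> n) - t i\<bar>) - real n * ext_error n t \<sigma>))"
proof -
  define v where "v = (\<lambda>i. if i < length (ext_matrix n)
      then (map (eval M d) (ext_matrix n) ! i) \<sigma> else 0)"
  have v: "v (i * Suc n + j) = d (\<sigma> i) (\<sigma> j)" if "i < n" "j \<le> n" for i j
  proof -
    have "i * Suc n + j < n * Suc n"
    proof -
      have "i * Suc n + j < Suc i * Suc n" using that by simp
      also have "\<dots> \<le> n * Suc n" using that by (intro mult_le_mono1) simp
      finally show ?thesis .
    qed
    moreover have "(i * Suc n + j) div Suc n = i" "(i * Suc n + j) mod Suc n = j"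
      using that by (simp_all add: div_mult_self3 del: mult_Suc_right)
    ultimately show ?thesis by (simp add: v_def ext_matrix_def del: mult_Suc_right)
  qed
  have "eval M d (FConn (ext_conn n t) (ext_matrix n)) \<sigma> = ext_conn n t v"
    by (simp add: v_def)
  also have "\<dots> = min 1 (max 0 ((\<Sum>i<n. \<bar>d (\<sigma> i) (\<sigma> n) - t i\<bar>) - real n * ext_error n t \<sigma>))"
    unfolding ext_conn_def ext_error_def
    by (intro arg_cong2[where f=min] arg_cong2[where f=max] arg_cong2[where f="(-)"]
        arg_cong2[where f="(*)"] sum.cong refl) (simp_all only: v lessThan_iff less_imp_le order_refl)
  finally show ?thesis .
qed

lemma ext_error_upd: "ext_error n t (\<sigma>(n := a)) = ext_error n t \<sigma>"
  by (simp add: ext_error_def)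

lemma ext_error_ge:
  assumes "i < n" "j < n"
  shows "t i \<le> t j + d (z i) (z j) + ext_error n t z" "d (z i) (z j) \<le> t i + t j + ext_error n t z"
proof -
  let ?g = "\<lambda>i j. max 0 (t i - t j - d (z i) (z j)) + max 0 (d (z i) (z j) - t i - t j)"
  have "?g i j \<le> (\<Sum>j<n. ?g i j)" using assms by (intro member_le_sum) auto
  also have "\<dots> \<le> ext_error n t z"
    unfolding ext_error_def using assms by (intro member_le_sum sum_nonneg) auto
  finally show "t i \<le> t j + d (z i) (z j) + ext_error n t z"
    "d (z i) (z j) \<le> t i + t j + ext_error n t z" by linarith+
qed

lemma ext_error_nonneg: "0 \<le> ext_error n t z"
  unfolding ext_error_def by (intro sum_nonneg) auto

end

lemma ext_sentence_in_Th:
  assumes "urysohn_sphere X dX" "\<And>i. i < n \<Longrightarrow> t i \<in> {0..1}"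
  shows "ext_sentence n t \<in> Th X dX"
proof -
  interpret unit_metric X dX
    using assms(1) by (simp add: urysohn_sphere_def metric_structure_unit_metric)
  have "eval X dX (FInf n (FConn (ext_conn n t) (ext_matrix n))) \<sigma> = 0" if \<sigma>: "range \<sigma> \<subseteq> X" for \<sigma>
  proof -
    have \<sigma>X: "\<sigma> i \<in> X" for i using \<sigma> by auto
    let ?e = "ext_error n t \<sigma>" and ?f = "\<lambda>a. eval X dX (FConn (ext_conn n t) (ext_matrix n)) (\<sigma>(n := a))"
    define g where "g = (\<lambda>y. glue ?e {..<n} (\<lambda>i. t i + dX (\<sigma> i) y))"
    have "katetov X (\<lambda>x. x) g" and g: "\<And>i. i < n \<Longrightarrow> \<bar>g (\<sigma> i) - t i\<bar> \<le> ?e"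
      unfolding g_def
      using katetov_correction[where z=\<sigma> and t=t and I="{..<n}" and \<eta>="?e"] ext_error_nonneg
        ext_error_ge \<sigma>X assms(2) by auto
    then have "katetov {..<n} \<sigma> (\<lambda>i. g (\<sigma> i))" using \<sigma>X unfolding katetov_def by auto
    then obtain y where y: "y \<in> X" "\<And>i. i < n \<Longrightarrow> dX y (\<sigma> i) = g (\<sigma> i)"
      using urysohn_sphere_extension[OF assms(1), of "{..<n}"] by blast
    \<comment> \<open>This bound is the origin of the factor \<open>real n\<close> in
      \<open>ext_conn\<close>.\<close>
    have "(\<Sum>i<n. \<bar>dX (\<sigma> i) y - t i\<bar>) \<le> (\<Sum>i<n. ?e)"
      using g y by (intro sum_mono) (simp add: commute)
    then have "?f y = 0" by (simp add: eval_ext_conn ext_error_upd del: eval.simps)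
    moreover have *: "?f a \<in> {0..1}" if "a \<in> X" for a
      using wf_ext_conn \<sigma> that by (intro eval_in_unit) auto
    ultimately have "(INF a\<in>X. ?f a) \<le> 0"
      using y by (intro cINF_lower2[where x=y]) (auto intro!: bdd_belowI[of _ 0])
    moreover have "0 \<le> (INF a\<in>X. ?f a)" using * nonempty by (intro cINF_greatest) auto
    ultimately show ?thesis by simp
  qed
  then show ?thesis
    using all_eval_foldr_FSup_eq_0[of "FInf n (FConn (ext_conn n t) (ext_matrix n))" "[0..<n]"]
      wf_ext_conn fv_ext_sentence
    unfolding Th_def ext_sentence_def by simp
qed

lemma approximate_extension:
  assumes "urysohn_sphere X dX" "models M d (Th X dX)" "0 < \<epsilon>" "finite I" "unit_metric.katetov M d I z t"
  shows "\<exists>y\<in>M. \<forall>i\<in>I. \<bar>d y (z i) - t i\<bar> \<le> \<epsilon>"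
proof -
  interpret unit_metric M d
    using assms(2) by (simp add: models_def metric_structure_unit_metric)
  obtain e :: "nat \<Rightarrow> 'c" and n where e: "bij_betw e {..<n} I"
    using ex_bij_betw_nat_finite[OF assms(4)] by (auto simp: atLeast0LessThan)
  define s where "s = (\<lambda>i. t (e i))"
  obtain m where m: "m \<in> M" using nonempty by blast
  define \<sigma> where "\<sigma> = (\<lambda>i. if i < n then z (e i) else m)"
  have eI: "e i \<in> I" if "i < n" for i using bij_betwE[OF e] that by auto
  have \<sigma>: "range \<sigma> \<subseteq> M" using assms(5) eI m unfolding \<sigma>_def katetov_def by auto
  have s: "s i \<in> {0..1}" if "i < n" for i
    using assms(5) eI[OF that] katetov_nonneg[OF assms(5)] unfolding s_def katetov_def by simp
  have "ext_sentence n s \<in> Th X dX" by (rule ext_sentence_in_Th[OF assms(1) s])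
  then have "\<forall>\<sigma>. range \<sigma> \<subseteq> M \<longrightarrow> eval M d (ext_sentence n s) \<sigma> = 0"
    using assms(2) unfolding models_def by blast
  then have "eval M d (FInf n (FConn (ext_conn n s) (ext_matrix n))) \<sigma> = 0"
    using all_eval_foldr_FSup_eq_0[of "FInf n (FConn (ext_conn n s) (ext_matrix n))" "[0..<n]"]
      wf_ext_conn \<sigma> unfolding ext_sentence_def by simp
  moreover have "ext_error n s \<sigma> = 0"
    unfolding ext_error_def
  proof (intro sum.neutral ballI)
    fix i j assume "i \<in> {..<n}" "j \<in> {..<n}"
    then have "e i \<in> I" "e j \<in> I" "\<sigma> i = z (e i)" "\<sigma> j = z (e j)" using eI by (auto simp: \<sigma>_def)
    then have "s i \<le> s j + d (\<sigma> i) (\<sigma> j)" "d (\<sigma> i) (\<sigma> j) \<le> s i + s j"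
      using assms(5) unfolding katetov_def s_def by simp_all
    then show "max 0 (s i - s j - d (\<sigma> i) (\<sigma> j)) + max 0 (d (\<sigma> i) (\<sigma> j) - s i - s j) = 0"
      by simp
  qed
  ultimately have inf: "(INF a\<in>M. min 1 (max 0 (\<Sum>i<n. \<bar>d (\<sigma> i) a - s i\<bar>))) = 0"
    by (simp add: eval_ext_conn ext_error_upd del: eval.simps(2))
  \<comment> \<open>The formula is cut off at 1, so only a value below 1 bounds the sum
    itself.\<close>
  have "min \<epsilon> 1 > 0" using assms(3) by simp
  have "\<exists>y\<in>M. min 1 (max 0 (\<Sum>i<n. \<bar>d (\<sigma> i) y - s i\<bar>)) < min \<epsilon> 1"
  proof (rule ccontr)
    assume "\<not> ?thesis"
    then have "min \<epsilon> 1 \<le> (INF a\<in>M. min 1 (max 0 (\<Sum>i<n. \<bar>d (\<sigma> i) a - s i\<bar>)))"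
      using nonempty by (intro cINF_greatest) (auto simp: not_less)
    then show False using inf \<open>min \<epsilon> 1 > 0\<close> by simp
  qed
  then obtain y where y: "y \<in> M" "(\<Sum>i<n. \<bar>d (\<sigma> i) y - s i\<bar>) < \<epsilon>" by fastforce
  have "\<bar>d y (z i) - t i\<bar> \<le> \<epsilon>" if i: "i \<in> I" for i
  proof -
    have "i \<in> e ` {..<n}" using i bij_betw_imp_surj_on[OF e] by simp
    then obtain k where k: "k \<in> {..<n}" "i = e k" by (rule imageE)
    have "\<bar>d (\<sigma> k) y - s k\<bar> \<le> (\<Sum>i<n. \<bar>d (\<sigma> i) y - s i\<bar>)"
      using k by (intro member_le_sum) auto
    then show ?thesis using k y by (simp add: \<sigma>_def s_def commute)
  qed
  then show ?thesis using y by blast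
qed

text \<open>The type demands the distances up to every positive error. A finite part of it involves
  a least error, which \<open>approximate_extension\<close> achieves; a realization of the whole has
  the exact distances.\<close>

lemma saturated_extension:
  fixes d :: "'u \<Rightarrow> 'u \<Rightarrow> real"
  assumes "urysohn_sphere X dX" "models M d (Th X dX)" "saturated M d \<kappa>"
    and D: "D \<subseteq> M" "|D| <o \<kappa>" "unit_metric.katetov M d D (\<lambda>x. x) t"
  shows "\<exists>y\<in>M. \<forall>x\<in>D. d y x = t x"
proof -
  interpret unit_metric M d
    using assms(2) by (simp add: models_def metric_structure_unit_metric)
  define cond :: "'u \<times> real \<Rightarrow> (nat, 'u) pfm" where
    "cond = (\<lambda>(x, \<epsilon>). (FConn (\<lambda>v. min 1 (max 0 (\<bar>v 0 - t x\<bar> - \<epsilon>))) [FDist (Inl 0) (Inr 0)], [x]))"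
  define p where "p = cond ` (D \<times> {0<..})"
  have pval: "pval M d (cond (x, \<epsilon>)) a = min 1 (max 0 (\<bar>d (a 0) x - t x\<bar> - \<epsilon>))" for x \<epsilon> a
    by (simp add: cond_def pval_def)
  have cont: "continuous_on S (\<lambda>v::nat \<Rightarrow> real. min 1 (max 0 (\<bar>v 0 - t x\<bar> - \<epsilon>)))" for S x \<epsilon>
    by (intro continuous_intros continuous_on_subset[OF continuous_on_product_coordinates]) auto
  have "p \<subseteq> formulas_over D {..<1}"
    using cont by (auto simp: p_def cond_def formulas_over_def)
  moreover have "\<exists>a. realizes M d {..<1} a q" if q: "q \<subseteq> p" "finite q" for q
  proof -
    obtain E where E: "E \<subseteq> D \<times> {0<..}" "finite E" "q = cond ` E"
      using finite_subset_image[OF q(2)] q(1) unfolding p_def by blast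
    define \<epsilon> where "\<epsilon> = Min (insert 1 (snd ` E))"
    have "0 < \<epsilon>" using E(1,2) unfolding \<epsilon>_def by auto
    moreover have \<epsilon>: "\<epsilon> \<le> e" if "(x, e) \<in> E" for x e
      using E(2) that unfolding \<epsilon>_def by (intro Min_le) force+
    moreover have "katetov (fst ` E) (\<lambda>x. x) t" using D(3) E(1) unfolding katetov_def by fastforce
    ultimately obtain y where "y \<in> M" "\<And>x. x \<in> fst ` E \<Longrightarrow> \<bar>d y x - t x\<bar> \<le> \<epsilon>"
      using approximate_extension[OF assms(1,2), of \<epsilon> "fst ` E" "\<lambda>x. x" t] E(2) by auto
    then have "realizes M d {..<1} (\<lambda>_. y) q"
      using \<epsilon> unfolding realizes_def E(3) by (force simp: pval)
    then show ?thesis by blast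
  qed
  ultimately obtain a where a: "realizes M d {..<1} a p"
    using assms(3) D(1,2) unfolding saturated_def by meson
  have "d (a 0) x = t x" if "x \<in> D" for x
  proof -
    have "\<bar>d (a 0) x - t x\<bar> \<le> 0 + \<epsilon>" if "0 < \<epsilon>" for \<epsilon>
    proof -
      have "pval M d (cond (x, \<epsilon>)) a = 0"
        using a that \<open>x \<in> D\<close> unfolding realizes_def p_def by blast
      then show ?thesis by (simp add: pval min_def max_def split: if_splits)
    qed
    then have "\<bar>d (a 0) x - t x\<bar> \<le> 0" by (rule field_le_epsilon)
    then show ?thesis by simp
  qed
  moreover have "a 0 \<in> M" using a by (auto simp: realizes_def)
  ultimately show ?thesis by blast
qed

section \<open>Formulas are uniformly continuous in the distance matrix\<close>

lemma compact_unit_cube: "compact (unit_cube n)"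
proof -
  have "unit_cube n = PiE UNIV (\<lambda>i. if i < n then {0..1} else {0})"
    by (auto simp: unit_cube_def PiE_UNIV_domain Pi_iff split: if_splits)
  moreover have "compactin (product_topology (\<lambda>_. euclidean) UNIV)
      (PiE UNIV (\<lambda>i::nat. if i < n then {0..1::real} else {0}))"
    unfolding compactin_PiE by auto
  ultimately show ?thesis by (simp add: euclidean_product_topology)
qed

text \<open>The weights \<open>(1/2) ^ n\<close> in the metric of the product sum to 2.\<close>

lemma dist_fun_le:
  fixes v w :: "nat \<Rightarrow> real"
  assumes "\<And>i. \<bar>v i - w i\<bar> \<le> \<delta>"
  shows "dist v w \<le> 2 * \<delta>"
proof -
  have sm: "summable (\<lambda>n::nat. (1/2) ^ n :: real)" by (simp add: summable_geometric)
  have le: "(1/2) ^ n * min (dist (v (from_nat n)) (w (from_nat n))) 1 \<le> (1/2) ^ n * \<delta>" for n :: nat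
    using assms by (intro mult_left_mono) (auto simp: dist_real_def min_le_iff_disj)
  have "dist v w \<le> (\<Sum>n. (1/2) ^ n * \<delta>)"
    unfolding dist_fun_def
  proof (rule suminf_le[OF le])
    show "summable (\<lambda>n. (1/2) ^ n * \<delta>)" using sm by (rule summable_mult2)
    show "summable (\<lambda>n. (1/2) ^ n * min (dist (v (from_nat n)) (w (from_nat n))) 1)"
      by (rule summable_comparison_test'[OF sm, of 0]) simp
  qed
  also have "\<dots> = 2 * \<delta>" using suminf_mult2[OF sm, of \<delta>] by (simp add: suminf_geometric)
  finally show ?thesis .
qed

lemma unit_cube_uniformly_continuous:
  fixes u :: "(nat \<Rightarrow> real) \<Rightarrow> real"
  assumes "continuous_on (unit_cube n) u" "0 < \<epsilon>"
  shows "\<exists>\<delta>>0. \<forall>v\<in>unit_cube n. \<forall>w\<in>unit_cube n. (\<forall>i<n. \<bar>v i - w i\<bar> \<le> \<delta>) \<longrightarrow> \<bar>u v - u w\<bar> \<le> \<epsilon>"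
proof -
  obtain \<delta> where \<delta>: "0 < \<delta>"
    "\<And>v w. v \<in> unit_cube n \<Longrightarrow> w \<in> unit_cube n \<Longrightarrow> dist v w < \<delta> \<Longrightarrow> dist (u v) (u w) < \<epsilon>"
    using compact_uniformly_continuous[OF assms(1) compact_unit_cube] assms(2)
    unfolding uniformly_continuous_on_def by metis
  have "\<bar>u v - u w\<bar> \<le> \<epsilon>"
    if vw: "v \<in> unit_cube n" "w \<in> unit_cube n" "\<forall>i<n. \<bar>v i - w i\<bar> \<le> \<delta> / 3" for v w
  proof -
    have "\<bar>v i - w i\<bar> \<le> \<delta> / 3" for i
      using vw \<delta>(1) by (cases "i < n") (auto simp: unit_cube_def)
    then have "dist v w \<le> 2 * (\<delta> / 3)" by (rule dist_fun_le)
    then have "dist v w < \<delta>" using \<delta>(1) by simp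
    then show ?thesis using \<delta>(2)[OF vw(1,2)] by (simp add: dist_real_def less_imp_le)
  qed
  then show ?thesis using \<delta>(1) by (intro exI[of _ "\<delta> / 3"]) auto
qed

section \<open>Models with exact one-point extensions, and back-and-forth\<close>

lemma finite_fv: "finite (fv \<phi>)"
  by (induction \<phi>) auto

text \<open>The independence results use saturation only through exact one-point extensions over
  sets of cardinality at most \<open>\<kappa>\<close>. An infinite \<open>\<kappa>\<close> admits
  countable sets and finite unions.\<close>

locale urysohn_model = unit_metric M d for M :: "'u set" and d +
  fixes \<kappa> :: "'k rel"
  assumes Cinfinite: "Cinfinite \<kappa>"
    and extension: "\<And>D t. D \<subseteq> M \<Longrightarrow> |D| \<le>o \<kappa> \<Longrightarrow> katetov D (\<lambda>x. x) t \<Longrightarrow> \<exists>y\<in>M. \<forall>x\<in>D. d y x = t x"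
begin

lemma extension_indexed:
  assumes "|z ` I| \<le>o \<kappa>" "katetov I z t"
  shows "\<exists>y\<in>M. \<forall>i\<in>I. d y (z i) = t i"
proof -
  obtain s where s: "katetov (z ` I) (\<lambda>x. x) s" "\<forall>i\<in>I. s (z i) = t i"
    using katetov_by_set[OF assms(2)] by blast
  moreover have "z ` I \<subseteq> M" using assms(2) by (auto simp: katetov_def)
  ultimately show ?thesis using extension[OF _ assms(1) s(1)] by fastforce
qed

lemma card_of_countable_le:
  assumes "countable S"
  shows "|S| \<le>o \<kappa>"
proof -
  obtain f :: "_ \<Rightarrow> nat" where "inj_on f S" using assms by (auto simp: countable_def)
  then have "|S| \<le>o |UNIV :: nat set|" by (intro card_of_ordLeqI[of f]) auto
  also have "|UNIV :: nat set| =o natLeq" by (rule card_of_nat)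
  also have "natLeq \<le>o \<kappa>" by (rule natLeq_ordLeq_cinfinite[OF Cinfinite])
  finally show ?thesis .
qed

text \<open>A back-and-forth argument in which both sides are only approximately isometric.\<close>

lemma eval_uniformly_continuous:
  fixes \<phi> :: "'v fm"
  assumes "wf_fm \<phi>" "0 < \<epsilon>"
  shows "\<exists>\<delta>>0. \<forall>\<sigma> \<sigma>'. (\<forall>x\<in>fv \<phi>. \<sigma> x \<in> M \<and> \<sigma>' x \<in> M) \<and>
    (\<forall>x\<in>fv \<phi>. \<forall>y\<in>fv \<phi>. \<bar>d (\<sigma> x) (\<sigma> y) - d (\<sigma>' x) (\<sigma>' y)\<bar> \<le> \<delta>) \<longrightarrow>
    \<bar>eval M d \<phi> \<sigma> - eval M d \<phi> \<sigma>'\<bar> \<le> \<epsilon>"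
proof -
  define close where "close = (\<lambda>\<delta> V (\<sigma>::'v \<Rightarrow> 'u) \<sigma>'. (\<forall>x\<in>V. \<sigma> x \<in> M \<and> \<sigma>' x \<in> M) \<and>
    (\<forall>x\<in>V. \<forall>y\<in>V. \<bar>d (\<sigma> x) (\<sigma> y) - d (\<sigma>' x) (\<sigma>' y)\<bar> \<le> \<delta>))"
  have close_sym: "close \<delta> V \<sigma>' \<sigma>" if "close \<delta> V \<sigma> \<sigma>'" for \<delta> V \<sigma> \<sigma>'
    using that by (auto simp: close_def abs_minus_commute)
  \<comment> \<open>The new point is found by \<open>katetov_correction\<close>, whose cost is the
    error \<open>\<delta>\<close> already present. Quantifiers therefore leave
    \<open>\<delta>\<close> unchanged; it shrinks only at connectives.\<close>
  have step: "\<exists>a'\<in>M. close \<delta> V (\<sigma>(x := a)) (\<sigma>'(x := a'))"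
    if "close \<delta> (V - {x}) \<sigma> \<sigma>'" "a \<in> M" "0 \<le> \<delta>" "finite V" for \<delta> V \<sigma> \<sigma>' x a
  proof -
    let ?V = "V - {x}"
    have \<sigma>: "\<sigma> y \<in> M" "\<sigma>' y \<in> M" if "y \<in> ?V" for y
      using that \<open>close \<delta> ?V \<sigma> \<sigma>'\<close> by (auto simp: close_def)
    have c: "\<bar>d (\<sigma> y) (\<sigma> z) - d (\<sigma>' y) (\<sigma>' z)\<bar> \<le> \<delta>" if "y \<in> ?V" "z \<in> ?V" for y z
      using that \<open>close \<delta> ?V \<sigma> \<sigma>'\<close> by (auto simp: close_def)
    define g where "g = (\<lambda>w. glue \<delta> ?V (\<lambda>y. d a (\<sigma> y) + d (\<sigma>' y) w))"
    have lip: "d a (\<sigma> y) \<le> d a (\<sigma> z) + d (\<sigma>' y) (\<sigma>' z) + \<delta>" if "y \<in> ?V" "z \<in> ?V" for y z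
      using triangle[of a "\<sigma> z" "\<sigma> y"] c[OF that] \<sigma>(1)[OF that(1)] \<sigma>(1)[OF that(2)] \<open>a \<in> M\<close>
      by (simp add: commute)
    have sum: "d (\<sigma>' y) (\<sigma>' z) \<le> d a (\<sigma> y) + d a (\<sigma> z) + \<delta>" if "y \<in> ?V" "z \<in> ?V" for y z
      using triangle[of "\<sigma> y" a "\<sigma> z"] c[OF that] \<sigma>(1)[OF that(1)] \<sigma>(1)[OF that(2)] \<open>a \<in> M\<close>
      by (simp add: commute)
    have "katetov M (\<lambda>x. x) g" and g: "\<And>y. y \<in> ?V \<Longrightarrow> \<bar>g (\<sigma>' y) - d a (\<sigma> y)\<bar> \<le> \<delta>"
      unfolding g_def
      using katetov_correction[where z=\<sigma>' and t="\<lambda>y. d a (\<sigma> y)" and I="?V" and \<eta>=\<delta>]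
        \<open>0 \<le> \<delta>\<close> \<sigma> le_one \<open>a \<in> M\<close> lip sum by auto
    then have "katetov ?V \<sigma>' (\<lambda>y. g (\<sigma>' y))" using \<sigma> by (simp add: katetov_def)
    then obtain a' where a': "a' \<in> M" "\<And>y. y \<in> ?V \<Longrightarrow> d a' (\<sigma>' y) = g (\<sigma>' y)"
      using extension_indexed[of \<sigma>' ?V] card_of_countable_le[of "\<sigma>' ` ?V"] \<open>finite V\<close>
      by (metis countable_finite finite_Diff finite_imageI)
    then have "\<bar>d a (\<sigma> y) - d a' (\<sigma>' y)\<bar> \<le> \<delta>" "\<bar>d (\<sigma> y) a - d (\<sigma>' y) a'\<bar> \<le> \<delta>" if "y \<in> ?V" for y
      using g[OF that] that by (auto simp: commute abs_minus_commute)
    then show ?thesis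
      using a'(1) \<sigma> c \<open>a \<in> M\<close> \<open>0 \<le> \<delta>\<close> by (intro bexI[of _ a']) (auto simp: close_def)
  qed
  have "\<exists>\<delta>>0. \<forall>\<sigma> \<sigma>'. close \<delta> (fv \<phi>) \<sigma> \<sigma>' \<longrightarrow> \<bar>eval M d \<phi> \<sigma> - eval M d \<phi> \<sigma>'\<bar> \<le> \<epsilon>"
    using assms
  proof (induction \<phi> arbitrary: \<epsilon>)
    case (FDist x y)
    then show ?case by (intro exI[of _ \<epsilon>]) (auto simp: close_def)
  next
    case (FConn u \<phi>s)
    have wf: "wf_fm (\<phi>s ! i)" if "i < length \<phi>s" for i
      using FConn.prems(1) that by (auto simp: list_all_length)
    obtain \<delta>0 where \<delta>0: "0 < \<delta>0" "\<And>v w. \<lbrakk>v \<in> unit_cube (length \<phi>s); w \<in> unit_cube (length \<phi>s);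
        \<forall>i<length \<phi>s. \<bar>v i - w i\<bar> \<le> \<delta>0\<rbrakk> \<Longrightarrow> \<bar>u v - u w\<bar> \<le> \<epsilon>"
      using unit_cube_uniformly_continuous[of "length \<phi>s" u \<epsilon>] FConn.prems by auto
    have "\<forall>i<length \<phi>s. \<exists>\<delta>>0. \<forall>\<sigma> \<sigma>'. close \<delta> (fv (\<phi>s ! i)) \<sigma> \<sigma>' \<longrightarrow>
        \<bar>eval M d (\<phi>s ! i) \<sigma> - eval M d (\<phi>s ! i) \<sigma>'\<bar> \<le> \<delta>0"
      using FConn.IH wf \<delta>0(1) by simp
    then obtain \<delta>s where \<delta>s: "\<And>i. i < length \<phi>s \<Longrightarrow> 0 < \<delta>s i"
      "\<And>i \<sigma> \<sigma>'. i < length \<phi>s \<Longrightarrow> close (\<delta>s i) (fv (\<phi>s ! i)) \<sigma> \<sigma>' \<Longrightarrow>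
        \<bar>eval M d (\<phi>s ! i) \<sigma> - eval M d (\<phi>s ! i) \<sigma>'\<bar> \<le> \<delta>0"
      by metis
    define \<delta> where "\<delta> = Min (insert 1 (\<delta>s ` {..<length \<phi>s}))"
    have "0 < \<delta>" unfolding \<delta>_def using \<delta>s(1) by auto
    moreover have "\<bar>eval M d (FConn u \<phi>s) \<sigma> - eval M d (FConn u \<phi>s) \<sigma>'\<bar> \<le> \<epsilon>"
      if cl: "close \<delta> (fv (FConn u \<phi>s)) \<sigma> \<sigma>'" for \<sigma> \<sigma>'
    proof -
      have sub: "fv (\<phi>s ! i) \<subseteq> fv (FConn u \<phi>s)" if "i < length \<phi>s" for i
        using nth_mem[OF that] by auto
      have cube: "(\<lambda>i. if i < length \<phi>s then (map (eval M d) \<phi>s ! i) \<tau> else 0) \<in> unit_cube (length \<phi>s)"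
        if \<tau>: "\<And>x. x \<in> fv (FConn u \<phi>s) \<Longrightarrow> \<tau> x \<in> M" for \<tau>
      proof -
        have "eval M d (\<phi>s ! i) \<tau> \<in> {0..1}" if "i < length \<phi>s" for i
          using sub[OF that] \<tau> by (intro eval_in_unit wf[OF that]) blast
        then show ?thesis by (simp add: unit_cube_def)
      qed
      have "\<bar>eval M d (\<phi>s ! i) \<sigma> - eval M d (\<phi>s ! i) \<sigma>'\<bar> \<le> \<delta>0" if i: "i < length \<phi>s" for i
      proof (rule \<delta>s(2)[OF i])
        have "\<delta> \<le> \<delta>s i" unfolding \<delta>_def using i by (intro Min_le) auto
        then show "close (\<delta>s i) (fv (\<phi>s ! i)) \<sigma> \<sigma>'"
          using cl sub[OF i] unfolding close_def by (meson order_trans subsetD)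
      qed
      moreover have "\<sigma> x \<in> M" "\<sigma>' x \<in> M" if "x \<in> fv (FConn u \<phi>s)" for x
        using cl that unfolding close_def by blast+
      ultimately show ?thesis
        using \<delta>0(2)[OF cube cube, of \<sigma> \<sigma>'] by simp
    qed
    ultimately show ?case by blast
  next
    case (FSup x \<phi>)
    obtain \<delta> where \<delta>: "0 < \<delta>" "\<And>\<sigma> \<sigma>'. close \<delta> (fv \<phi>) \<sigma> \<sigma>' \<Longrightarrow> \<bar>eval M d \<phi> \<sigma> - eval M d \<phi> \<sigma>'\<bar> \<le> \<epsilon>"
      using FSup.IH[OF _ FSup.prems(2)] FSup.prems(1) by auto
    have le: "eval M d (FSup x \<phi>) \<sigma> \<le> eval M d (FSup x \<phi>) \<sigma>' + \<epsilon>"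
      if cl: "close \<delta> (fv \<phi> - {x}) \<sigma> \<sigma>'" for \<sigma> \<sigma>'
    proof -
      have u: "eval M d \<phi> (\<sigma>'(x := a)) \<in> {0..1}" if "a \<in> M" for a
        using FSup.prems cl that by (intro eval_in_unit) (auto simp: close_def)
      have "eval M d \<phi> (\<sigma>(x := a)) \<le> (SUP a\<in>M. eval M d \<phi> (\<sigma>'(x := a))) + \<epsilon>" if a: "a \<in> M" for a
      proof -
        obtain a' where a': "a' \<in> M" "close \<delta> (fv \<phi>) (\<sigma>(x := a)) (\<sigma>'(x := a'))"
          using step[OF cl a] \<delta>(1) finite_fv by (metis less_imp_le)
        have "eval M d \<phi> (\<sigma>'(x := a')) \<le> (SUP a\<in>M. eval M d \<phi> (\<sigma>'(x := a)))"
          using u a'(1) by (intro cSUP_upper) (auto intro!: bdd_aboveI[of _ 1])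
        then show ?thesis using \<delta>(2)[OF a'(2)] by linarith
      qed
      then show ?thesis unfolding eval.simps using nonempty by (intro cSUP_least)
    qed
    have "\<bar>eval M d (FSup x \<phi>) \<sigma> - eval M d (FSup x \<phi>) \<sigma>'\<bar> \<le> \<epsilon>"
      if "close \<delta> (fv (FSup x \<phi>)) \<sigma> \<sigma>'" for \<sigma> \<sigma>'
      using le[of \<sigma> \<sigma>'] le[of \<sigma>' \<sigma>] close_sym[OF that] that unfolding fv.simps by linarith
    then show ?case using \<delta>(1) by blast
  next
    case (FInf x \<phi>)
    obtain \<delta> where \<delta>: "0 < \<delta>" "\<And>\<sigma> \<sigma>'. close \<delta> (fv \<phi>) \<sigma> \<sigma>' \<Longrightarrow> \<bar>eval M d \<phi> \<sigma> - eval M d \<phi> \<sigma>'\<bar> \<le> \<epsilon>"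
      using FInf.IH[OF _ FInf.prems(2)] FInf.prems(1) by auto
    have le: "eval M d (FInf x \<phi>) \<sigma>' - \<epsilon> \<le> eval M d (FInf x \<phi>) \<sigma>"
      if cl: "close \<delta> (fv \<phi> - {x}) \<sigma> \<sigma>'" for \<sigma> \<sigma>'
    proof -
      have u: "eval M d \<phi> (\<sigma>'(x := a)) \<in> {0..1}" if "a \<in> M" for a
        using FInf.prems cl that by (intro eval_in_unit) (auto simp: close_def)
      have "(INF a\<in>M. eval M d \<phi> (\<sigma>'(x := a))) - \<epsilon> \<le> eval M d \<phi> (\<sigma>(x := a))" if a: "a \<in> M" for a
      proof -
        obtain a' where a': "a' \<in> M" "close \<delta> (fv \<phi>) (\<sigma>(x := a)) (\<sigma>'(x := a'))"
          using step[OF cl a] \<delta>(1) finite_fv by (metis less_imp_le)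
        have "(INF a\<in>M. eval M d \<phi> (\<sigma>'(x := a))) \<le> eval M d \<phi> (\<sigma>'(x := a'))"
          using u a'(1) by (intro cINF_lower) (auto intro!: bdd_belowI[of _ 0])
        then show ?thesis using \<delta>(2)[OF a'(2)] by linarith
      qed
      then show ?thesis unfolding eval.simps using nonempty by (intro cINF_greatest)
    qed
    have "\<bar>eval M d (FInf x \<phi>) \<sigma> - eval M d (FInf x \<phi>) \<sigma>'\<bar> \<le> \<epsilon>"
      if "close \<delta> (fv (FInf x \<phi>)) \<sigma> \<sigma>'" for \<sigma> \<sigma>'
      using le[of \<sigma> \<sigma>'] le[of \<sigma>' \<sigma>] close_sym[OF that] that unfolding fv.simps by linarith
    then show ?case using \<delta>(1) by blast
  qed
  then show ?thesis unfolding close_def .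
qed

text \<open>A metric form of quantifier elimination: equal distance matrices are close for every
  modulus, so the values differ by less than any tolerance.\<close>

lemma eval_cong:
  assumes "wf_fm \<phi>" "\<And>x. x \<in> fv \<phi> \<Longrightarrow> \<sigma> x \<in> M \<and> \<sigma>' x \<in> M"
    and "\<And>x y. x \<in> fv \<phi> \<Longrightarrow> y \<in> fv \<phi> \<Longrightarrow> d (\<sigma> x) (\<sigma> y) = d (\<sigma>' x) (\<sigma>' y)"
  shows "eval M d \<phi> \<sigma> = eval M d \<phi> \<sigma>'"
proof -
  have "\<bar>eval M d \<phi> \<sigma> - eval M d \<phi> \<sigma>'\<bar> \<le> 0 + \<epsilon>" if "0 < \<epsilon>" for \<epsilon>
    using eval_uniformly_continuous[OF assms(1) that] assms(2,3) by auto
  then have "\<bar>eval M d \<phi> \<sigma> - eval M d \<phi> \<sigma>'\<bar> \<le> 0" by (rule field_le_epsilon)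
  then show ?thesis by simp
qed

section \<open>Realizing metric extensions\<close>

text \<open>\<open>extension\<close> yields one point at a time and \<open>S\<close> may be
  uncountable, so a partial realization that is maximal by Zorn's lemma is shown to be total.
  \<open>\<rho>\<close> is only a pseudometric, since several indices may stand for one
  point.\<close>

lemma realize_over_set:
  assumes Y: "Y \<subseteq> M" "|Y| \<le>o \<kappa>" and S: "|S| \<le>o \<kappa>"
    and \<rho>: "\<And>s. s \<in> S \<Longrightarrow> \<rho> s s = 0" "\<And>s t. s \<in> S \<Longrightarrow> t \<in> S \<Longrightarrow> \<rho> s t = \<rho> t s"
      "\<And>s t. s \<in> S \<Longrightarrow> t \<in> S \<Longrightarrow> \<rho> s t \<le> 1"
      "\<And>s t r. s \<in> S \<Longrightarrow> t \<in> S \<Longrightarrow> r \<in> S \<Longrightarrow> \<rho> s r \<le> \<rho> s t + \<rho> t r"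
    and g: "\<And>s. s \<in> S \<Longrightarrow> katetov Y (\<lambda>x. x) (g s)"
      "\<And>s t y. s \<in> S \<Longrightarrow> t \<in> S \<Longrightarrow> y \<in> Y \<Longrightarrow> g s y \<le> g t y + \<rho> s t \<and> \<rho> s t \<le> g s y + g t y"
  shows "\<exists>f. \<forall>s\<in>S. f s \<in> M \<and> (\<forall>y\<in>Y. d (f s) y = g s y) \<and> (\<forall>t\<in>S. d (f s) (f t) = \<rho> s t)"
proof -
  define \<A> where "\<A> = {r. r \<subseteq> S \<times> M \<and> (\<forall>(s, u)\<in>r. (\<forall>y\<in>Y. d u y = g s y) \<and> (\<forall>(t, v)\<in>r. d u v = \<rho> s t))}"
  have "\<exists>r\<in>\<A>. \<forall>r'\<in>\<A>. r \<subseteq> r' \<longrightarrow> r' = r"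
  proof (rule subset_Zorn')
    fix \<C> assume ch: "subset.chain \<A> \<C>"
    then have sub: "\<And>r. r \<in> \<C> \<Longrightarrow> r \<in> \<A>" by (auto simp: subset_chain_def)
    have "\<exists>r\<in>\<C>. p \<in> r \<and> q \<in> r" if pq: "p \<in> \<Union> \<C>" "q \<in> \<Union> \<C>" for p q
    proof -
      obtain a b where ab: "a \<in> \<C>" "p \<in> a" "b \<in> \<C>" "q \<in> b" using pq by blast
      then have "a \<subseteq> b \<or> b \<subseteq> a" using ch unfolding subset_chain_def by blast
      then show ?thesis using ab by blast
    qed
    moreover have "d u v = \<rho> s t" if "r \<in> \<C>" "(s, u) \<in> r" "(t, v) \<in> r" for r s u t v
      using sub[OF that(1)] that(2,3) unfolding \<A>_def by fast
    ultimately have "d u v = \<rho> s t" if "(s, u) \<in> \<Union> \<C>" "(t, v) \<in> \<Union> \<C>" for s u t v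
      using that by metis
    moreover have "d u y = g s y" "s \<in> S" "u \<in> M" if "(s, u) \<in> \<Union> \<C>" "y \<in> Y" for s u y
      using that sub unfolding \<A>_def by fast+
    moreover have "s \<in> S" "u \<in> M" if "(s, u) \<in> \<Union> \<C>" for s u
      using that sub unfolding \<A>_def by fast+
    ultimately show "\<Union> \<C> \<in> \<A>" unfolding \<A>_def by fast
  qed
  then obtain r where r: "r \<in> \<A>" and max: "\<And>r'. r' \<in> \<A> \<Longrightarrow> r \<subseteq> r' \<Longrightarrow> r' = r" by blast
  have rS: "s \<in> S" "u \<in> M" if "(s, u) \<in> r" for s u using that r unfolding \<A>_def by fast+
  have rg: "d u y = g s y" if "(s, u) \<in> r" "y \<in> Y" for s u y using that r unfolding \<A>_def by fast
  have r\<rho>: "d u v = \<rho> s t" if "(s, u) \<in> r" "(t, v) \<in> r" for s u t v using that r unfolding \<A>_def by fast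
  have single: "u = v" if "(s, u) \<in> r" "(s, v) \<in> r" for s u v
    using r\<rho>[OF that] \<rho>(1) rS that zero by metis
  have dom: "\<exists>u. (s, u) \<in> r" if s: "s \<in> S" for s
  proof -
    \<comment> \<open>A disjoint sum, because an element of \<open>Y\<close> may also be a point
      realized before; \<open>extension_indexed\<close> tolerates such repetitions.\<close>
    let ?I = "Y <+> r" and ?z = "case_sum (\<lambda>x. x) snd" and ?t = "case_sum (g s) (\<lambda>(t, u). \<rho> s t)"
    have "?z ` ?I = Y \<union> snd ` r" by (force simp: Plus_def image_Un image_image)
    moreover have "|snd ` r| \<le>o \<kappa>"
    proof -
      \<comment> \<open>By \<open>single\<close>, the points realized so far are no more numerous
        than \<open>S\<close>.\<close>
      have "snd ` r \<subseteq> (\<lambda>s. THE u. (s, u) \<in> r) ` S"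
      proof
        fix u assume "u \<in> snd ` r"
        then obtain s where s: "(s, u) \<in> r" by auto
        then have "u = (THE u. (s, u) \<in> r)" using single by (intro the_equality[symmetric])
        then show "u \<in> (\<lambda>s. THE u. (s, u) \<in> r) ` S" using rS(1)[OF s] by (rule image_eqI)
      qed
      then show ?thesis
        using S card_of_image card_of_mono1 ordLeq_transitive by metis
    qed
    ultimately have "|?z ` ?I| \<le>o \<kappa>" using Un_Cinfinite_bound Y(2) Cinfinite by metis
    moreover have "katetov ?I ?z ?t"
    proof -
      have 1: "y \<in> M \<and> g s y \<le> 1" if "y \<in> Y" for y using g(1)[OF s] that by (simp add: katetov_def)
      have 2: "g s y \<le> g s y' + d y y' \<and> d y y' \<le> g s y + g s y'" if "y \<in> Y" "y' \<in> Y" for y y'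
        using g(1)[OF s] that by (simp add: katetov_def)
      have 3: "\<rho> s t \<le> \<rho> s t' + d u u' \<and> d u u' \<le> \<rho> s t + \<rho> s t'" if "(t, u) \<in> r" "(t', u') \<in> r" for t u t' u'
        using r\<rho>[OF that] \<rho>(2)[OF s] \<rho>(2) \<rho>(4)[of s t' t] \<rho>(4)[of t s t'] rS that s by metis
      have 4: "g s y \<le> \<rho> s t + d y u \<and> d y u \<le> g s y + \<rho> s t \<and> \<rho> s t \<le> g s y + d u y"
        if "y \<in> Y" "(t, u) \<in> r" for y t u
        using rg[OF that(2,1)] g(2)[of s t y] g(2)[of t s y] \<rho>(2) rS(1)[OF that(2)] s that(1)
        by (smt (verit) commute)
      show ?thesis
        unfolding katetov_def
        using 1 2 3 4 rS \<rho>(3)[OF s] by (fastforce simp: commute add.commute)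
    qed
    ultimately obtain y where y: "y \<in> M" "\<And>i. i \<in> ?I \<Longrightarrow> d y (?z i) = ?t i"
      using extension_indexed[of ?z ?I ?t] by blast
    have yY: "d y x = g s x" if "x \<in> Y" for x using y(2)[OF InlI[OF that]] by simp
    have yr: "d y u = \<rho> s t" "d u y = \<rho> t s" if "(t, u) \<in> r" for t u
      using y(2)[OF InrI[OF that]] \<rho>(2)[OF s rS(1)[OF that]] by (simp_all add: commute)
    have "insert (s, y) r \<in> \<A>"
      using s y(1) yY yr rS rg r\<rho> \<rho>(1)[OF s] unfolding \<A>_def by auto
    then show ?thesis using max by blast
  qed
  then obtain f where f: "\<And>s. s \<in> S \<Longrightarrow> (s, f s) \<in> r" by metis
  show ?thesis
    by (intro exI[of _ f] ballI conjI) (auto intro: rS(2)[OF f] rg[OF f] r\<rho>[OF f f])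
qed

text \<open>Takes an arbitrary \<open>\<rho>\<close> so as to cover abstract index sets whose points
  are yet to be realized.\<close>

definition dense_of_card :: "'s set \<Rightarrow> ('s \<Rightarrow> 's \<Rightarrow> real) \<Rightarrow> bool" where
  "dense_of_card S \<rho> \<longleftrightarrow> (\<exists>S0\<subseteq>S. |S0| \<le>o \<kappa> \<and> (\<forall>s\<in>S. \<forall>e>0. \<exists>t\<in>S0. \<rho> s t < e))"

text \<open>\<open>S\<close> and \<open>Y\<close> may have more than \<open>\<kappa>\<close>
  elements. Once \<open>S0\<close> is realized over \<open>Y0\<close>, each \<open>s\<close> is
  realized on its own over \<open>Y0\<close> and the image of \<open>S0\<close>. Density then forces
  the distances to the rest of \<open>Y\<close> and between points chosen separately.\<close>

lemma realize:
  assumes Y: "Y \<subseteq> M" "dense_of_card Y d" and S: "dense_of_card S \<rho>"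
    and \<rho>: "\<And>s. s \<in> S \<Longrightarrow> \<rho> s s = 0" "\<And>s t. s \<in> S \<Longrightarrow> t \<in> S \<Longrightarrow> \<rho> s t = \<rho> t s"
      "\<And>s t. s \<in> S \<Longrightarrow> t \<in> S \<Longrightarrow> \<rho> s t \<le> 1"
      "\<And>s t r. s \<in> S \<Longrightarrow> t \<in> S \<Longrightarrow> r \<in> S \<Longrightarrow> \<rho> s r \<le> \<rho> s t + \<rho> t r"
    and g: "\<And>s. s \<in> S \<Longrightarrow> katetov Y (\<lambda>x. x) (g s)"
      "\<And>s t y. s \<in> S \<Longrightarrow> t \<in> S \<Longrightarrow> y \<in> Y \<Longrightarrow> g s y \<le> g t y + \<rho> s t \<and> \<rho> s t \<le> g s y + g t y"
  shows "\<exists>f. \<forall>s\<in>S. f s \<in> M \<and> (\<forall>y\<in>Y. d (f s) y = g s y) \<and> (\<forall>t\<in>S. d (f s) (f t) = \<rho> s t)"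
proof -
  obtain Y0 where Y0: "Y0 \<subseteq> Y" "|Y0| \<le>o \<kappa>" "\<And>y e. y \<in> Y \<Longrightarrow> 0 < e \<Longrightarrow> \<exists>x\<in>Y0. d y x < e"
    using Y(2) unfolding dense_of_card_def by blast
  obtain S0 where S0: "S0 \<subseteq> S" "|S0| \<le>o \<kappa>" "\<And>s e. s \<in> S \<Longrightarrow> 0 < e \<Longrightarrow> \<exists>t\<in>S0. \<rho> s t < e"
    using S unfolding dense_of_card_def by blast
  note SS = subsetD[OF S0(1)] and YY = subsetD[OF Y0(1)]
  have gY: "g s y \<le> 1" "g s y \<le> g s y' + d y y'" "d y y' \<le> g s y + g s y'"
    if "s \<in> S" "y \<in> Y" "y' \<in> Y" for s y y'
    using g(1)[OF that(1)] that(2,3) by (simp_all add: katetov_def)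
  have kat: "katetov Y0 (\<lambda>x. x) (g s)" if "s \<in> S" for s
    using g(1)[OF that] YY by (simp add: katetov_def)
  have "\<exists>f. \<forall>s\<in>S0. f s \<in> M \<and> (\<forall>y\<in>Y0. d (f s) y = g s y) \<and> (\<forall>t\<in>S0. d (f s) (f t) = \<rho> s t)"
    using Y(1) Y0(1,2) S0(2) SS YY \<rho> g kat by (intro realize_over_set) auto
  then obtain f0 where f0: "\<And>s. s \<in> S0 \<Longrightarrow> f0 s \<in> M" "\<And>s y. s \<in> S0 \<Longrightarrow> y \<in> Y0 \<Longrightarrow> d (f0 s) y = g s y"
    "\<And>s t. s \<in> S0 \<Longrightarrow> t \<in> S0 \<Longrightarrow> d (f0 s) (f0 t) = \<rho> s t" by blast
  have "\<exists>u\<in>M. (\<forall>y\<in>Y0. d u y = g s y) \<and> (\<forall>t\<in>S0. d u (f0 t) = \<rho> s t)" if s: "s \<in> S" for s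
  proof -
    let ?I = "Y0 <+> S0" and ?z = "case_sum (\<lambda>x. x) f0" and ?t = "case_sum (g s) (\<rho> s)"
    have "?z ` ?I = Y0 \<union> f0 ` S0" by (auto simp: Plus_def image_Un image_image)
    moreover have "|f0 ` S0| \<le>o \<kappa>" using S0(2) card_of_image ordLeq_transitive by metis
    ultimately have "|?z ` ?I| \<le>o \<kappa>" using Un_Cinfinite_bound Y0(2) Cinfinite by metis
    moreover have "katetov ?I ?z ?t"
    proof -
      have 3: "\<rho> s t \<le> \<rho> s t' + d (f0 t) (f0 t') \<and> d (f0 t) (f0 t') \<le> \<rho> s t + \<rho> s t'" if "t \<in> S0" "t' \<in> S0" for t t'
        using f0(3)[OF that] \<rho>(2) \<rho>(4)[of s t' t] \<rho>(4)[of t s t'] SS that s by metis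
      have 4: "g s y \<le> \<rho> s t + d y (f0 t) \<and> d y (f0 t) \<le> g s y + \<rho> s t \<and> \<rho> s t \<le> g s y + d y (f0 t)"
        if "y \<in> Y0" "t \<in> S0" for y t
        using f0(2)[OF that(2,1)] g(2)[of s t y] g(2)[of t s y] \<rho>(2)[of s t] SS[OF that(2)] s YY[OF that(1)]
        by (smt (verit) commute)
      show ?thesis
        unfolding katetov_def
        using 3 4 f0(1) \<rho>(3)[OF s] gY[OF s] Y(1) YY SS by (fastforce simp: commute add.commute)
    qed
    ultimately obtain y where y: "y \<in> M" "\<And>i. i \<in> ?I \<Longrightarrow> d y (?z i) = ?t i"
      using extension_indexed[of ?z ?I ?t] by blast
    have "d y x = g s x" if "x \<in> Y0" for x using y(2)[OF InlI[OF that]] by simp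
    moreover have "d y (f0 t) = \<rho> s t" if "t \<in> S0" for t using y(2)[OF InrI[OF that]] by simp
    ultimately show ?thesis using y(1) by blast
  qed
  then obtain f where f: "\<And>s. s \<in> S \<Longrightarrow> f s \<in> M" "\<And>s y. s \<in> S \<Longrightarrow> y \<in> Y0 \<Longrightarrow> d (f s) y = g s y"
    "\<And>s t. s \<in> S \<Longrightarrow> t \<in> S0 \<Longrightarrow> d (f s) (f0 t) = \<rho> s t" by metis
  have "d (f s) y = g s y" if "s \<in> S" "y \<in> Y" for s y
  proof -
    have "\<bar>d (f s) y - g s y\<bar> \<le> 0 + e" if "0 < e" for e
    proof -
      obtain x where x: "x \<in> Y0" "d y x < e / 2" using Y0(3)[OF \<open>y \<in> Y\<close>, of "e / 2"] \<open>0 < e\<close> by auto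
      then have "x \<in> Y" "y \<in> M" "x \<in> M" using YY Y(1) \<open>y \<in> Y\<close> by auto
      then show ?thesis
        using x f(2)[OF \<open>s \<in> S\<close> x(1)] triangle[of "f s" x y] triangle[of "f s" y x] f(1)[OF \<open>s \<in> S\<close>]
          gY(2)[OF \<open>s \<in> S\<close>, of x y] gY(2)[OF \<open>s \<in> S\<close>, of y x] \<open>y \<in> Y\<close> by (simp add: commute)
    qed
    then have "\<bar>d (f s) y - g s y\<bar> \<le> 0" by (rule field_le_epsilon)
    then show ?thesis by simp
  qed
  moreover have "d (f s) (f s') = \<rho> s s'" if "s \<in> S" "s' \<in> S" for s s'
  proof -
    have "\<bar>d (f s) (f s') - \<rho> s s'\<bar> \<le> 0 + e" if "0 < e" for e
    proof -
      obtain t where t: "t \<in> S0" "\<rho> s' t < e / 2" using S0(3)[OF \<open>s' \<in> S\<close>, of "e / 2"] \<open>0 < e\<close> by auto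
      then have "t \<in> S" using SS by auto
      then show ?thesis
        using t f(3)[OF \<open>s \<in> S\<close> t(1)] f(3)[OF \<open>s' \<in> S\<close> t(1)]
          triangle[of "f s" "f0 t" "f s'"] triangle[of "f s" "f s'" "f0 t"]
          f(1)[OF \<open>s \<in> S\<close>] f(1)[OF \<open>s' \<in> S\<close>] f0(1)[OF t(1)]
          \<rho>(4)[of s s' t] \<rho>(4)[of s t s'] \<rho>(2)[of s' t] \<open>s \<in> S\<close> \<open>s' \<in> S\<close> by (simp add: commute)
    qed
    then have "\<bar>d (f s) (f s') - \<rho> s s'\<bar> \<le> 0" by (rule field_le_epsilon)
    then show ?thesis by simp
  qed
  ultimately show ?thesis using f(1) by blast
qed

end

section \<open>Amalgamation distances\<close>

context unit_metric
begin

lemma d_max_le: "c \<in> C \<Longrightarrow> d_max d x y C \<le> d x c + d y c"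
  unfolding d_max_def by (auto intro!: cINF_lower2[where x=c] bdd_belowI[of _ 0])

lemma d_max_le_one: "d_max d x y C \<le> 1"
proof (cases "C = {}")
  case False
  then obtain c where "c \<in> C" by blast
  then show ?thesis
    unfolding d_max_def by (auto intro!: cINF_lower2[where x=c] bdd_belowI[of _ 0])
qed (simp add: d_max_def)

lemma le_d_max: "r \<le> 1 \<Longrightarrow> (\<And>c. c \<in> C \<Longrightarrow> r \<le> d x c + d y c) \<Longrightarrow> r \<le> d_max d x y C"
  unfolding d_max_def by (auto intro!: cINF_greatest)

lemma d_max_commute: "d_max d x y C = d_max d y x C"
  by (simp add: d_max_def add.commute)

lemma d_min_commute: "d_min d x y C = d_min d y x C"
  by (simp add: d_min_def commute abs_minus_commute)

context
  fixes C assumes C: "C \<subseteq> M"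
begin

lemma abs_diff_le_d_min:
  assumes "x \<in> M" "y \<in> M" "c \<in> C"
  shows "\<bar>d x c - d y c\<bar> \<le> d_min d x y C"
proof -
  have "\<bar>d x c - d y c\<bar> \<le> 1" if "c \<in> C" for c
    using le_one[of x c] le_one[of y c] assms(1,2) subsetD[OF C that] nonneg[of x c] nonneg[of y c]
    by linarith
  then have "\<bar>d x c - d y c\<bar> \<le> (SUP c\<in>C. \<bar>d x c - d y c\<bar>)"
    using assms(3) by (intro cSUP_upper bdd_aboveI[of _ 1]) auto
  then show ?thesis using assms(3) by (auto simp: d_min_def)
qed

lemma dist_le_d_min: "d x y \<le> 3 * d_min d x y C"
  by (simp add: d_min_def max_def)

lemma d_min_nonneg: "0 \<le> d_min d x y C"
  using dist_le_d_min[of x y] nonneg[of x y] by linarith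

lemma d_min_le: "(\<And>c. c \<in> C \<Longrightarrow> \<bar>d x c - d y c\<bar> \<le> r) \<Longrightarrow> d x y \<le> 3 * r \<Longrightarrow> d_min d x y C \<le> r"
  using order_trans[OF nonneg[of x y], of "3 * r"] unfolding d_min_def by (auto intro!: cSUP_least)

lemma abs_dist_diff_le: "x \<in> M \<Longrightarrow> y \<in> M \<Longrightarrow> c \<in> M \<Longrightarrow> \<bar>d x c - d y c\<bar> \<le> d x y"
  using triangle[of x y c] triangle[of y x c] by (simp add: commute)

lemma d_min_le_dist: "x \<in> M \<Longrightarrow> y \<in> M \<Longrightarrow> d_min d x y C \<le> d x y"
  using abs_dist_diff_le C nonneg[of x y] by (intro d_min_le) auto

lemma dist_le_d_max: "x \<in> M \<Longrightarrow> y \<in> M \<Longrightarrow> d x y \<le> d_max d x y C"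
  using triangle[of x _ y] C by (intro le_d_max le_one) (auto simp: commute)

lemma d_min_triangle:
  assumes "x \<in> M" "y \<in> M" "z \<in> M"
  shows "d_min d x z C \<le> d_min d x y C + d_min d y z C"
proof (rule d_min_le)
  show "\<bar>d x c - d z c\<bar> \<le> d_min d x y C + d_min d y z C" if "c \<in> C" for c
    using abs_diff_le_d_min[OF assms(1,2) that] abs_diff_le_d_min[OF assms(2,3) that] by linarith
  show "d x z \<le> 3 * (d_min d x y C + d_min d y z C)"
    using dist_le_d_min[of x y] dist_le_d_min[of y z] triangle[OF assms] by argo
qed

text \<open>Each sum of distances to some \<open>c\<close> changes by at most the two
  \<open>d_min\<close> terms. Hence an extension along \<open>d_min\<close> preserves lower bounds
  by \<open>d_max\<close>.\<close>

lemma d_max_le_d_max_add_d_min: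
  assumes "x \<in> M" "x' \<in> M" "y \<in> M" "y' \<in> M"
  shows "d_max d x y C \<le> d_max d x' y' C + d_min d x x' C + d_min d y y' C"
proof -
  have "d_max d x y C - d_min d x x' C - d_min d y y' C \<le> d_max d x' y' C"
  proof (rule le_d_max)
    show "d_max d x y C - d_min d x x' C - d_min d y y' C \<le> 1"
      using d_max_le_one[of x y C] d_min_nonneg[of x x'] d_min_nonneg[of y y'] by linarith
    show "d_max d x y C - d_min d x x' C - d_min d y y' C \<le> d x' c + d y' c" if "c \<in> C" for c
      using d_max_le[OF that, of x y] abs_diff_le_d_min[OF assms(1,2) that]
        abs_diff_le_d_min[OF assms(3,4) that] by linarith
  qed
  then show ?thesis by linarith
qed

text \<open>With \<open>c\<close> used for \<open>y\<close>, \<open>z\<close> and \<open>c'\<close>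
  for \<open>x\<close>, \<open>y\<close>, the single point \<open>c\<close> already serves
  \<open>x\<close> and \<open>z\<close>: \<open>x\<close> reaches \<open>c\<close> by way of
  \<open>c'\<close> and \<open>y\<close>.\<close>

lemma d_max_triangle:
  assumes "x \<in> M" "y \<in> M" "z \<in> M"
  shows "d_max d x z C \<le> d_max d x y C + d_max d y z C"
proof -
  have "d_max d x z C - d_max d x y C \<le> d_max d y z C"
  proof (rule le_d_max)
    show "d_max d x z C - d_max d x y C \<le> 1"
      using d_max_le_one[of x z C] dist_le_d_max[OF assms(1,2)] nonneg[of x y] by linarith
    fix c assume c: "c \<in> C"
    have "d_max d x z C - (d y c + d z c) \<le> d_max d x y C"
    proof (rule le_d_max)
      show "d_max d x z C - (d y c + d z c) \<le> 1"
        using d_max_le_one[of x z C] nonneg[of y c] nonneg[of z c] by linarith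
      show "d_max d x z C - (d y c + d z c) \<le> d x c' + d y c'" if "c' \<in> C" for c'
        using d_max_le[OF c, of x z] triangle[of x c' y] triangle[of x y c] that c C assms
        by (auto simp: commute subset_iff)
    qed
    then show "d_max d x z C - d_max d x y C \<le> d y c + d z c" by linarith
  qed
  then show ?thesis by linarith
qed

lemma d_max_le_dist_add:
  assumes "x \<in> M" "y \<in> M" "z \<in> M"
  shows "d_max d x z C \<le> d x y + d_max d y z C"
  using d_max_le_d_max_add_d_min[OF assms(1,2,3,3)] d_min_le_dist[OF assms(1,2)]
    d_min_le_dist[OF assms(3,3)] assms by simp

end

text \<open>The Katetov inequalities with \<open>d\<close> replaced by \<open>d_min\<close> on the
  Lipschitz side and by \<open>d_max\<close> on the other. For subsets of \<open>M\<close> both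
  become stronger, as \<open>d\<close> lies between \<open>d_min\<close> and
  \<open>d_max\<close>.\<close>

definition independent_dist :: "'u set \<Rightarrow> 'u set \<Rightarrow> ('u \<Rightarrow> real) \<Rightarrow> bool" where
  "independent_dist C Y g \<longleftrightarrow> (\<forall>x\<in>Y. \<forall>y\<in>Y. d_max d x y C \<le> g x + g y \<and> g x \<le> g y + d_min d x y C)"

lemma independent_dist_subset: "independent_dist C Y g \<Longrightarrow> Y' \<subseteq> Y \<Longrightarrow> independent_dist C Y' g"
  unfolding independent_dist_def by blast

text \<open>Enlarging \<open>C\<close> can only lower \<open>d_max\<close> and raise
  \<open>d_min\<close>, so both persist exactly if every added point respects the old
  bounds.\<close>

lemma amalgamation_distances_iff:
  assumes "A \<subseteq> M" "B \<subseteq> M" "C \<subseteq> M"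
  shows "(\<forall>x\<in>B. \<forall>y\<in>B. d_max d x y (A \<union> C) = d_max d x y C \<and> d_min d x y (A \<union> C) = d_min d x y C) \<longleftrightarrow>
    (\<forall>a\<in>A. independent_dist C B (d a))" (is "?L \<longleftrightarrow> ?R")
proof
  assume L: ?L
  show ?R
    unfolding independent_dist_def
  proof (intro ballI)
    fix a x y assume a: "a \<in> A" and xy: "x \<in> B" "y \<in> B"
    have "d_max d x y C \<le> d x a + d y a" using L xy a d_max_le[of a "A \<union> C" x y] by simp
    moreover have "\<bar>d x a - d y a\<bar> \<le> d_min d x y C"
      using L xy a abs_diff_le_d_min[of "A \<union> C" x y a] assms by (auto simp: subset_iff)
    ultimately show "d_max d x y C \<le> d a x + d a y \<and> d a x \<le> d a y + d_min d x y C"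
      by (simp add: commute)
  qed
next
  assume R: ?R
  have AC: "A \<union> C \<subseteq> M" using assms by simp
  have eq: "d_max d x y (A \<union> C) = d_max d x y C \<and> d_min d x y (A \<union> C) = d_min d x y C"
    if xy: "x \<in> B" "y \<in> B" for x y
  proof (intro conjI antisym)
    have xyM: "x \<in> M" "y \<in> M" using xy assms(2) by auto
    have R': "d_max d x y C \<le> d x a + d y a" "\<bar>d x a - d y a\<bar> \<le> d_min d x y C" if "a \<in> A" for a
      using R xy that d_min_commute[of x y C] unfolding independent_dist_def
      by (auto simp: commute abs_le_iff) (smt (verit))+
    show "d_max d x y (A \<union> C) \<le> d_max d x y C"
      by (rule le_d_max[OF d_max_le_one]) (simp add: d_max_le)
    show "d_max d x y C \<le> d_max d x y (A \<union> C)"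
      by (rule le_d_max[OF d_max_le_one]) (use R'(1) d_max_le in blast)
    show "d_min d x y (A \<union> C) \<le> d_min d x y C"
      by (rule d_min_le[OF AC]) (use R'(2) abs_diff_le_d_min[OF assms(3) xyM] dist_le_d_min[OF assms(3)] in blast)+
    show "d_min d x y C \<le> d_min d x y (A \<union> C)"
      by (rule d_min_le[OF assms(3)]) (use abs_diff_le_d_min[OF AC xyM] dist_le_d_min[OF AC] in blast)+
  qed
  then show ?L by blast
qed

end

text \<open>Rounding down to multiples of \<open>\<eta>\<close> turns the functions
  \<open>F i j\<close> into finitely many colours of pairs.\<close>

lemma ramsey_approximate:
  fixes F :: "nat \<Rightarrow> nat \<Rightarrow> 'p \<Rightarrow> real"
  assumes "finite P" "0 < \<eta>" and F: "\<And>i j p. p \<in> P \<Longrightarrow> F i j p \<in> {0..1}"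
  shows "\<exists>L. infinite L \<and> (\<forall>i\<in>L. \<forall>j\<in>L. \<forall>i'\<in>L. \<forall>j'\<in>L. i < j \<longrightarrow> i' < j' \<longrightarrow>
    (\<forall>p\<in>P. \<bar>F i j p - F i' j' p\<bar> \<le> \<eta>))"
proof -
  define col where "col = (\<lambda>i j. restrict (\<lambda>p. nat \<lfloor>F i j p / \<eta>\<rfloor>) P)"
  let ?V = "PiE P (\<lambda>_. {..nat \<lfloor>1 / \<eta>\<rfloor>})"
  have "finite ?V" using assms(1) by (intro finite_PiE) auto
  then obtain h :: "('p \<Rightarrow> nat) \<Rightarrow> nat" where h: "bij_betw h ?V {..<card ?V}"
    using ex_bij_betw_finite_nat by (auto simp: atLeast0LessThan)
  have col: "col i j \<in> ?V" for i j
    using F assms(2) unfolding col_def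
    by (auto intro!: nat_mono floor_mono divide_right_mono)
  \<comment> \<open>\<open>Ramsey2\<close> colours unordered pairs, whereas \<open>F\<close> is not
    symmetric in \<open>i\<close> and \<open>j\<close>; \<open>Min\<close> and \<open>Max\<close>
    restore the order.\<close>
  have "\<forall>x\<in>UNIV. \<forall>y\<in>UNIV. x \<noteq> y \<longrightarrow> h (col (Min {x, y}) (Max {x, y})) < card ?V"
    using bij_betwE[OF h] col by blast
  from Ramsey2[of UNIV "\<lambda>X. h (col (Min X) (Max X))" "card ?V", OF infinite_UNIV_nat this]
  obtain L t where L: "infinite L"
    "\<forall>x\<in>L. \<forall>y\<in>L. x \<noteq> y \<longrightarrow> h (col (Min {x, y}) (Max {x, y})) = t" by auto
  have close: "\<bar>F i j p - F i' j' p\<bar> \<le> \<eta>"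
    if ij: "i \<in> L" "j \<in> L" "i' \<in> L" "j' \<in> L" "i < j" "i' < j'" "p \<in> P" for i j i' j' p
  proof -
    have "i \<noteq> j" "i' \<noteq> j'" using ij(5,6) by simp_all
    note this = L(2)[rule_format, OF ij(1,2) this(1)] L(2)[rule_format, OF ij(3,4) this(2)]
    then have "h (col i j) = t" "h (col i' j') = t" using ij(5,6) by simp_all
    then have "col i j = col i' j'" using bij_betw_imp_inj_on[OF h] col by (metis inj_onD)
    then have "nat \<lfloor>F i j p / \<eta>\<rfloor> = nat \<lfloor>F i' j' p / \<eta>\<rfloor>"
      unfolding col_def using ij(7) by (metis restrict_apply')
    moreover have "0 \<le> \<lfloor>F i j p / \<eta>\<rfloor>" "0 \<le> \<lfloor>F i' j' p / \<eta>\<rfloor>" using F[OF ij(7)] assms(2) by auto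
    ultimately have "\<lfloor>F i j p / \<eta>\<rfloor> = \<lfloor>F i' j' p / \<eta>\<rfloor>" by (simp add: eq_nat_nat_iff)
    then have "\<bar>F i j p / \<eta> - F i' j' p / \<eta>\<bar> \<le> 1" by linarith
    then show ?thesis using assms(2) by (simp add: diff_divide_distrib[symmetric] abs_div_pos[symmetric] divide_le_eq)
  qed
  show ?thesis by (intro exI[of _ L] conjI ballI impI L(1) close)
qed

section \<open>Types and distances\<close>

context urysohn_model
begin

lemma dense_of_card_countable:
  assumes "countable S" "\<And>s. s \<in> S \<Longrightarrow> \<rho> s s = 0"
  shows "dense_of_card S \<rho>"
  unfolding dense_of_card_def
proof (intro exI[of _ S] conjI ballI allI impI)
  show "|S| \<le>o \<kappa>" by (rule card_of_countable_le[OF assms(1)])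
  show "\<exists>t\<in>S. \<rho> s t < e" if "s \<in> S" "0 < e" for s and e :: real
    using assms(2) that by force
qed simp

lemma dense_of_card_Un:
  assumes "dense_of_card S \<rho>" "dense_of_card T \<rho>"
  shows "dense_of_card (S \<union> T) \<rho>"
proof -
  obtain S0 T0 where ST: "S0 \<subseteq> S" "|S0| \<le>o \<kappa>" "\<And>s e. s \<in> S \<Longrightarrow> 0 < e \<Longrightarrow> \<exists>t\<in>S0. \<rho> s t < e"
    "T0 \<subseteq> T" "|T0| \<le>o \<kappa>" "\<And>s e. s \<in> T \<Longrightarrow> 0 < e \<Longrightarrow> \<exists>t\<in>T0. \<rho> s t < e"
    using assms unfolding dense_of_card_def by blast
  show ?thesis
    unfolding dense_of_card_def
  proof (intro exI[of _ "S0 \<union> T0"] conjI ballI allI impI)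
    show "S0 \<union> T0 \<subseteq> S \<union> T" using ST by auto
    show "|S0 \<union> T0| \<le>o \<kappa>" using ST(2,5) Cinfinite by (rule Un_Cinfinite_bound)
    show "\<exists>t\<in>S0 \<union> T0. \<rho> s t < e" if "s \<in> S \<union> T" "0 < e" for s e
      using ST(3,6) that by blast
  qed
qed

lemma wf_dist_eq:
  fixes r :: real
  shows "wf_fm (FConn (\<lambda>v. min 1 \<bar>v 0 - r\<bar>) [FDist s t])"
proof -
  have "continuous_on S (\<lambda>v::nat \<Rightarrow> real. min 1 \<bar>v 0 - r\<bar>)" for S
    by (intro continuous_intros continuous_on_subset[OF continuous_on_product_coordinates]) auto
  then show ?thesis by auto
qed

text \<open>Forwards, having a given distance is itself a condition in the type; backwards this is
  \<open>eval_cong\<close>. The hypothesis on types in \<open>divides\<close> thereby becomes a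
  system of equations between distances.\<close>

lemma tp_list_eq_iff:
  assumes "C \<subseteq> M" "set b \<subseteq> M" "set b' \<subseteq> M" "length b' = length b"
  shows "tp_list M d C b' = tp_list M d C b \<longleftrightarrow>
    (\<forall>p<length b. (\<forall>q<length b. d (b' ! p) (b' ! q) = d (b ! p) (b ! q)) \<and>
       (\<forall>c\<in>C. d (b' ! p) c = d (b ! p) c))" (is "?L \<longleftrightarrow> ?R")
proof
  assume L: ?L
  show ?R
  proof (intro allI impI conjI ballI)
    fix p assume p: "p < length b"
    show "d (b' ! p) (b' ! q) = d (b ! p) (b ! q)" if q: "q < length b" for q
    proof -
      have "(FConn (\<lambda>v. min 1 \<bar>v 0 - d (b ! p) (b ! q)\<bar>) [FDist (Inl p) (Inl q)], []) \<in> tp_list M d C b"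
        using p q wf_dist_eq by (auto simp: tp_list_def tp_def formulas_over_def pval_def)
      then show ?thesis unfolding L[symmetric]
        by (auto simp: tp_list_def tp_def pval_def min_def split: if_splits)
    qed
    show "d (b' ! p) c = d (b ! p) c" if c: "c \<in> C" for c
    proof -
      have "(FConn (\<lambda>v. min 1 \<bar>v 0 - d (b ! p) c\<bar>) [FDist (Inl p) (Inr 0)], [c]) \<in> tp_list M d C b"
        using p c wf_dist_eq by (auto simp: tp_list_def tp_def formulas_over_def pval_def)
      then show ?thesis unfolding L[symmetric]
        by (auto simp: tp_list_def tp_def pval_def min_def split: if_splits)
    qed
  qed
next
  assume R: ?R
  have "pval M d \<phi> (nth b') = pval M d \<phi> (nth b)" if \<phi>: "\<phi> \<in> formulas_over C {..<length b}" for \<phi>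
  proof -
    obtain \<psi> e where \<psi>: "\<phi> = (\<psi>, e)" "wf_fm \<psi>" "fv \<psi> \<subseteq> Inl ` {..<length b} \<union> Inr ` {..<length e}" "set e \<subseteq> C"
      using \<phi> by (cases \<phi>) (auto simp: formulas_over_def)
    have bM: "b ! p \<in> M" "b' ! p \<in> M" if "p < length b" for p
      using that assms(2-4) by (metis nth_mem subsetD)+
    have eC: "e ! k \<in> C" "e ! k \<in> M" if "k < length e" for k
      using that \<psi>(4) assms(1) by (meson nth_mem subsetD)+
    have Rb: "d (b' ! p) (b' ! q) = d (b ! p) (b ! q)" if "p < length b" "q < length b" for p q
      using R that by blast
    have Re: "d (b' ! p) (e ! k) = d (b ! p) (e ! k)" "d (e ! k) (b' ! p) = d (e ! k) (b ! p)"
      if "p < length b" "k < length e" for p k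
      using R that(1) eC(1)[OF that(2)] commute by metis+
    show ?thesis
      unfolding \<psi>(1) pval_def case_prod_conv
    proof (rule eval_cong[OF \<psi>(2)])
      fix x assume x: "x \<in> fv \<psi>"
      then show "case_sum ((!) b') ((!) e) x \<in> M \<and> case_sum ((!) b) ((!) e) x \<in> M"
        using \<psi>(3) bM eC by (auto dest!: subsetD[of "fv \<psi>"])
      fix y assume y: "y \<in> fv \<psi>"
      show "d (case_sum ((!) b') ((!) e) x) (case_sum ((!) b') ((!) e) y) =
            d (case_sum ((!) b) ((!) e) x) (case_sum ((!) b) ((!) e) y)"
        using subsetD[OF \<psi>(3) x] subsetD[OF \<psi>(3) y] Rb Re by auto
    qed
  qed
  then show ?L using assms(4) by (auto simp: tp_list_def tp_def)
qed

section \<open>Dividing formulas from failing amalgamation conditions\<close>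

text \<open>One coordinate and two parameters are enough to witness dividing, because
  \<open>independent_dist\<close> constrains one \<open>a\<close> and two points at a time.\<close>

definition pair_fm :: "'i \<Rightarrow> real \<Rightarrow> real \<Rightarrow> 'u \<Rightarrow> 'u \<Rightarrow> ('i, 'u) pfm" where
  "pair_fm a r s b1 b2 = (FConn (\<lambda>v. min 1 (\<bar>v 0 - r\<bar> + \<bar>v 1 - s\<bar>))
     [FDist (Inl a) (Inr 0), FDist (Inl a) (Inr 1)], [b1, b2])"

lemma pair_fm_in_formulas_over: "a \<in> A \<Longrightarrow> {b1, b2} \<subseteq> D \<Longrightarrow> pair_fm a r s b1 b2 \<in> formulas_over D A"
proof -
  have "continuous_on S (\<lambda>v::nat \<Rightarrow> real. min 1 (\<bar>v 0 - r\<bar> + \<bar>v 1 - s\<bar>))" for S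
    by (intro continuous_intros continuous_on_subset[OF continuous_on_product_coordinates]) auto
  then show "a \<in> A \<Longrightarrow> {b1, b2} \<subseteq> D \<Longrightarrow> pair_fm a r s b1 b2 \<in> formulas_over D A"
    by (auto simp: pair_fm_def formulas_over_def)
qed

lemma pval_pair_fm: "pval M d (pair_fm a r s b1 b2) x = min 1 (\<bar>d (x a) b1 - r\<bar> + \<bar>d (x a) b2 - s\<bar>)"
  by (simp add: pair_fm_def pval_def)

text \<open>The hypotheses on \<open>e\<close> are the triangle inequalities sorted by coincidences
  among the copies: three distinct copies, the first two equal, the outer two equal, one point in
  \<open>C\<close>. \<open>e p p\<close> may be positive, being the distance of two copies of one
  point.\<close>

lemma realize_sequence:
  fixes \<beta> :: "'p::countable \<Rightarrow> 'u"
  assumes C: "C \<subseteq> M" "dense_of_card C d" and \<beta>: "\<And>p. \<beta> p \<in> M"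
    and e: "\<And>p q. e p q = e q p" "\<And>p q. e p q \<le> 1" "\<And>p q r. e p r \<le> e p q + e q r"
      "\<And>p q r. e p r \<le> d (\<beta> p) (\<beta> q) + e q r" "\<And>p q r. d (\<beta> p) (\<beta> r) \<le> e p q + e q r"
      "\<And>p q c. c \<in> C \<Longrightarrow> d (\<beta> p) c \<le> d (\<beta> q) c + e p q \<and> e p q \<le> d (\<beta> p) c + d (\<beta> q) c"
  shows "\<exists>b :: nat \<Rightarrow> 'p \<Rightarrow> 'u. \<forall>i p. b i p \<in> M \<and> (\<forall>c\<in>C. d (b i p) c = d (\<beta> p) c) \<and>
    (\<forall>j q. d (b i p) (b j q) = (if i = j then d (\<beta> p) (\<beta> q) else e p q))"
proof -
  define \<rho> where "\<rho> = (\<lambda>(i :: nat, p) (j, q). if i = j then d (\<beta> p) (\<beta> q) else e p q)"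
  define g where "g = (\<lambda>(i :: nat, p). d (\<beta> p))"
  have "\<exists>f. \<forall>s\<in>UNIV. f s \<in> M \<and> (\<forall>c\<in>C. d (f s) c = g s c) \<and> (\<forall>t\<in>UNIV. d (f s) (f t) = \<rho> s t)"
  proof (rule realize[OF C])
    show "dense_of_card UNIV \<rho>" using \<beta> by (intro dense_of_card_countable) (auto simp: \<rho>_def split: prod.splits)
    show "\<rho> s s = 0" for s using \<beta> by (auto simp: \<rho>_def split: prod.splits)
    show "\<rho> s t = \<rho> t s" for s t by (auto simp: \<rho>_def commute e(1) split: prod.splits)
    show "\<rho> s t \<le> 1" for s t using le_one \<beta> e(2) by (auto simp: \<rho>_def split: prod.splits)
    show "\<rho> s r \<le> \<rho> s t + \<rho> t r" for s t r
    proof -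
      obtain i p j q k l where s: "s = (i, p)" "t = (j, q)" "r = (k, l)"
        by (metis surj_pair)
      show ?thesis
        using triangle[OF \<beta>[of p] \<beta>[of q] \<beta>[of l]] e(3)[of p l q] e(4)[of p l q] e(4)[of l p q] e(5)[of p l q]
          e(1)[of l p] e(1)[of l q] e(1)[of q p]
        by (auto simp: s \<rho>_def commute)
    qed
    show "katetov C (\<lambda>x. x) (g s)" for s
    proof -
      obtain i p where s: "s = (i, p)" by (metis surj_pair)
      have "d (\<beta> p) x \<le> d (\<beta> p) y + d x y \<and> d x y \<le> d (\<beta> p) x + d (\<beta> p) y"
        if "x \<in> C" "y \<in> C" for x y
        using triangle[OF \<beta>[of p], of y x] triangle[of x "\<beta> p" y] \<beta>[of p] that C(1)
          commute[of x "\<beta> p"] commute[of y x] by (simp add: subset_iff)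
      then show ?thesis
        using C(1) le_one[OF \<beta>] unfolding katetov_def s g_def by auto
    qed
    show "g s c \<le> g t c + \<rho> s t \<and> \<rho> s t \<le> g s c + g t c" if "c \<in> C" for s t c
    proof -
      obtain i p j q where s: "s = (i, p)" "t = (j, q)" by (metis surj_pair)
      have "c \<in> M" using that C(1) by auto
      then show ?thesis
        using e(6)[OF that, of p q] triangle[OF \<beta> \<beta>, of c p q] triangle[OF \<beta> _ \<beta>, of c p q]
        by (auto simp: s \<rho>_def g_def commute)
    qed
  qed
  then obtain f where f: "\<And>s. f s \<in> M" "\<And>s c. c \<in> C \<Longrightarrow> d (f s) c = g s c"
    "\<And>s t. d (f s) (f t) = \<rho> s t" by blast
  show ?thesis
    by (rule exI[of _ "\<lambda>i p. f (i, p)"]) (simp add: f g_def \<rho>_def)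
qed

text \<open>A point with distance about \<open>r\<close> from b1 in one copy and about
  \<open>s\<close> from b2 in another would break a triangle inequality with the cross distance
  \<open>e True False\<close>. Two copies already conflict, so \<open>k\<close> is 2.\<close>

lemma divides_pair_fm:
  fixes e :: "bool \<Rightarrow> bool \<Rightarrow> real" and a :: 'i
  assumes C: "C \<subseteq> M" "dense_of_card C d" and b: "b1 \<in> M" "b2 \<in> M" and a: "a \<in> I"
  defines "\<beta> \<equiv> \<lambda>p. if p then b1 else b2"
  assumes e: "\<And>p q. e p q = e q p" "\<And>p q. e p q \<le> 1" "\<And>p q r. e p r \<le> e p q + e q r"
      "\<And>p q r. e p r \<le> d (\<beta> p) (\<beta> q) + e q r" "\<And>p q r. d (\<beta> p) (\<beta> r) \<le> e p q + e q r"
      "\<And>p q c. c \<in> C \<Longrightarrow> d (\<beta> p) c \<le> d (\<beta> q) c + e p q \<and> e p q \<le> d (\<beta> p) c + d (\<beta> q) c"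
    and rs: "r + s < e True False \<or> e True False < r - s" "r \<in> {0..1}" "s \<in> {0..1}"
  shows "divides M d C I (pair_fm a r s b1 b2)"
proof -
  have \<beta>M: "\<beta> p \<in> M" for p using b by (simp add: \<beta>_def)
  have "\<exists>b' :: nat \<Rightarrow> bool \<Rightarrow> 'u. \<forall>i p. b' i p \<in> M \<and> (\<forall>c\<in>C. d (b' i p) c = d (\<beta> p) c) \<and>
    (\<forall>j q. d (b' i p) (b' j q) = (if i = j then d (\<beta> p) (\<beta> q) else e p q))"
    by (rule realize_sequence[where e=e, OF C \<beta>M]) (fact e)+
  then obtain b' :: "nat \<Rightarrow> bool \<Rightarrow> 'u" where "\<forall>i p. b' i p \<in> M \<and> (\<forall>c\<in>C. d (b' i p) c = d (\<beta> p) c) \<and>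
    (\<forall>j q. d (b' i p) (b' j q) = (if i = j then d (\<beta> p) (\<beta> q) else e p q))" ..
  then have b': "\<And>i p. b' i p \<in> M" "\<And>i p c. c \<in> C \<Longrightarrow> d (b' i p) c = d (\<beta> p) c"
    "\<And>i j p q. d (b' i p) (b' j q) = (if i = j then d (\<beta> p) (\<beta> q) else e p q)"
    by blast+
  \<comment> \<open>A third of the defect in the violated triangle inequality: two distances with
    errors up to \<open>\<epsilon>\<close> cannot make up for \<open>3 * \<epsilon>\<close>. Being
    below 1, \<open>\<epsilon>\<close> is not affected by the cut-off in
    \<open>pair_fm\<close>.\<close>
  define \<epsilon> where "\<epsilon> = max (e True False - (r + s)) (r - s - e True False) / 3"
  have e0: "0 \<le> e True False" using e(5)[of True True False] e(1)[of False True] nonneg[of "\<beta> True" "\<beta> True"] by linarith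
  have \<epsilon>: "0 < \<epsilon>" "\<epsilon> < 1" "\<epsilon> * 3 = e True False - (r + s) \<or> \<epsilon> * 3 = r - s - e True False"
    using rs e(2)[of True False] e0 unfolding \<epsilon>_def by (auto simp: max_def)
  define bs where "bs = (\<lambda>l. [b' l True, b' l False])"
  have "\<not> (\<exists>x\<in>I \<rightarrow> M. \<forall>l\<in>K. pval M d (pair_fm a r s (b' l True) (b' l False)) x \<le> \<epsilon>)" if "card K = 2" for K
  proof
    assume "\<exists>x\<in>I \<rightarrow> M. \<forall>l\<in>K. pval M d (pair_fm a r s (b' l True) (b' l False)) x \<le> \<epsilon>"
    then obtain x where x: "x \<in> I \<rightarrow> M" "\<And>l. l \<in> K \<Longrightarrow> pval M d (pair_fm a r s (b' l True) (b' l False)) x \<le> \<epsilon>" by blast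
    obtain i j where ij: "K = {i, j}" "i \<noteq> j" using \<open>card K = 2\<close> by (auto simp: card_2_iff)
    have xM: "x a \<in> M" using x(1) a by blast
    have "\<bar>d (x a) (b' l True) - r\<bar> + \<bar>d (x a) (b' l False) - s\<bar> \<le> \<epsilon>" if "l \<in> K" for l
      using x(2)[OF that] \<epsilon>(2) by (simp add: pval_pair_fm min_def split: if_splits)
    from this[of i] this[of j] have "\<bar>d (x a) (b' i True) - r\<bar> \<le> \<epsilon>" "\<bar>d (x a) (b' j False) - s\<bar> \<le> \<epsilon>"
      using ij by auto
    moreover have "d (b' i True) (b' j False) = e True False" using ij(2) b'(3) by simp
    ultimately show False
      using triangle[OF b'(1)[of i True] xM b'(1)[of j False]]
        triangle[OF xM b'(1)[of j False] b'(1)[of i True]] \<epsilon>(1,3) by (auto simp: commute)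
  qed
  moreover have "tp_list M d C (bs l) = tp_list M d C [b1, b2]" for l
  proof (subst tp_list_eq_iff[OF C(1)])
    have "d (b' l p) (b' l q) = d (\<beta> p) (\<beta> q)" for p q by (simp add: b'(3))
    then show "\<forall>p<length [b1, b2]. (\<forall>q<length [b1, b2]. d (bs l ! p) (bs l ! q) = d ([b1, b2] ! p) ([b1, b2] ! q)) \<and>
       (\<forall>c\<in>C. d (bs l ! p) c = d ([b1, b2] ! p) c)"
      using b'(2) by (auto simp: bs_def \<beta>_def less_Suc_eq)
  qed (use b b'(1) in \<open>auto simp: bs_def\<close>)
  ultimately show ?thesis
    using \<epsilon>(1) b'(1) unfolding divides_def pair_fm_def case_prod_conv
    by (intro exI[of _ bs] exI[of _ \<epsilon>] exI[of _ 2]) (auto simp: bs_def)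
qed

lemma independent_if_dividing_independent:
  assumes "A \<subseteq> M" "B \<subseteq> M" "C \<subseteq> M" "dense_of_card C d" "dividing_independent M d A C B" "a \<in> A"
  shows "independent_dist C B (d a)"
  unfolding independent_dist_def
proof (intro ballI)
  fix b1 b2 assume b: "b1 \<in> B" "b2 \<in> B"
  have M: "a \<in> M" "b1 \<in> M" "b2 \<in> M" using assms b by auto
  have no: "\<not> divides M d C A (pair_fm a (d a b1) (d a b2) b1 b2)"
  proof
    let ?\<phi> = "pair_fm a (d a b1) (d a b2) b1 b2"
    assume "divides M d C A ?\<phi>"
    moreover have "?\<phi> \<in> tp M d (B \<union> C) A (\<lambda>a. a)"
      using b assms(6) by (simp add: tp_def pair_fm_in_formulas_over pval_pair_fm)
    moreover have "?\<phi> \<in> formulas_over M A" using assms(6) M by (intro pair_fm_in_formulas_over) auto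
    ultimately have "type_divides M d C A (tp M d (B \<union> C) A (\<lambda>a. a))"
      unfolding type_divides_def realizes_def by blast
    then show False using assms(5) by (simp add: dividing_independent_def)
  qed
  let ?\<beta> = "\<lambda>p. if p then b1 else b2"
  have \<beta>: "?\<beta> p \<in> M" for p using M by simp
  have r: "d a b1 \<in> {0..1}" "d a b2 \<in> {0..1}" using M le_one by auto
  note divides = divides_pair_fm[OF assms(3,4) M(2,3) assms(6) _ _ _ _ _ _ _ r]
  have "d_max d b1 b2 C \<le> d a b1 + d a b2"
  proof (rule ccontr)
    assume lt: "\<not> ?thesis"
    have "divides M d C A (pair_fm a (d a b1) (d a b2) b1 b2)"
    proof (rule divides)
      \<comment> \<open>Distinct copies are amalgamated freely: these are the largest cross
        distances that the common distances to \<open>C\<close> permit.\<close>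
      let ?e = "\<lambda>p q. d_max d (?\<beta> p) (?\<beta> q) C"
      show "?e p q = ?e q p" for p q by (rule d_max_commute)
      show "?e p q \<le> 1" for p q by (rule d_max_le_one)
      show "?e p r \<le> ?e p q + ?e q r" for p q r by (rule d_max_triangle[OF assms(3) \<beta> \<beta> \<beta>])
      show "?e p r \<le> d (?\<beta> p) (?\<beta> q) + ?e q r" for p q r by (rule d_max_le_dist_add[OF assms(3) \<beta> \<beta> \<beta>])
      show "d (?\<beta> p) (?\<beta> r) \<le> ?e p q + ?e q r" for p q r
        using dist_le_d_max[OF assms(3) \<beta> \<beta>] d_max_triangle[OF assms(3) \<beta> \<beta> \<beta>] by (rule order_trans)
      show "d (?\<beta> p) c \<le> d (?\<beta> q) c + ?e p q \<and> ?e p q \<le> d (?\<beta> p) c + d (?\<beta> q) c" if "c \<in> C" for p q c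
        using triangle[OF \<beta> \<beta>, of c p q] dist_le_d_max[OF assms(3) \<beta> \<beta>, of p q]
          d_max_le[OF that, of "?\<beta> p" "?\<beta> q"] that assms(3) by (simp add: subset_iff)
      show "d a b1 + d a b2 < ?e True False \<or> ?e True False < d a b1 - d a b2" using lt by simp
    qed
    then show False using no by blast
  qed
  moreover have "d a b1 \<le> d a b2 + d_min d b1 b2 C"
  proof (rule ccontr)
    assume lt: "\<not> ?thesis"
    let ?m = "d_min d b1 b2 C"
    have m: "0 \<le> ?m" "?m \<le> d b1 b2" "d b1 b2 \<le> 3 * ?m" "d b1 b2 \<le> 1"
      using d_min_nonneg[OF assms(3)] d_min_le_dist[OF assms(3) M(2,3)] dist_le_d_min[OF assms(3)] le_one[OF M(2,3)] by auto
    have mc: "\<bar>d b1 c - d b2 c\<bar> \<le> ?m" "d b1 b2 \<le> d b1 c + d b2 c" if "c \<in> C" for c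
      using abs_diff_le_d_min[OF assms(3) M(2,3) that] triangle[of b1 c b2] M that assms(3)
      by (auto simp: commute)
    have "divides M d C A (pair_fm a (d a b1) (d a b2) b1 b2)"
    proof (rule divides)
      \<comment> \<open>The diagonal value is the least with
        \<open>d b1 b2 \<le> ?e p p + ?m\<close>. It must also be at most \<open>2 * ?m\<close>,
        which is where the third in \<open>d_min\<close> enters.\<close>
      let ?e = "\<lambda>p q. if p = q then d b1 b2 - ?m else ?m"
      show "?e p q = ?e q p" for p q by simp
      show "?e p q \<le> 1" for p q using m by auto
      show "?e p r \<le> ?e p q + ?e q r" for p q r :: bool using m by (cases p; cases q; cases r) auto
      show "?e p r \<le> d (?\<beta> p) (?\<beta> q) + ?e q r" for p q r
        using m M by (cases p; cases q; cases r) (auto simp: commute)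
      show "d (?\<beta> p) (?\<beta> r) \<le> ?e p q + ?e q r" for p q r
        using m M by (cases p; cases q; cases r) (auto simp: commute)
      show "d (?\<beta> p) c \<le> d (?\<beta> q) c + ?e p q \<and> ?e p q \<le> d (?\<beta> p) c + d (?\<beta> q) c" if "c \<in> C" for p q c
        using mc[OF that] m by (cases p; cases q) auto
      show "d a b1 + d a b2 < ?e True False \<or> ?e True False < d a b1 - d a b2" using lt by auto
    qed
    then show False using no by blast
  qed
  ultimately show "d_max d b1 b2 C \<le> d a b1 + d a b2 \<and> d a b1 \<le> d a b2 + d_min d b1 b2 C" by blast
qed

end

section \<open>Non-forking from the amalgamation conditions\<close>

context urysohn_model
begin

text \<open>As soon as one of the two points lies in \<open>C\<close>, both \<open>d_max\<close> and
  \<open>d_min\<close> collapse to \<open>d\<close>, and the condition becomes the triangle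
  inequality.\<close>

lemma independent_dist_Un:
  assumes "a \<in> M" "B \<subseteq> M" "C \<subseteq> M" "independent_dist C B (d a)"
  shows "independent_dist C (B \<union> C) (d a)"
  unfolding independent_dist_def
proof (intro ballI)
  fix x y assume xy: "x \<in> B \<union> C" "y \<in> B \<union> C"
  then have M: "x \<in> M" "y \<in> M" using assms by auto
  show "d_max d x y C \<le> d a x + d a y \<and> d a x \<le> d a y + d_min d x y C"
  proof (cases "x \<in> B \<and> y \<in> B")
    case True
    then show ?thesis using assms(4) by (simp add: independent_dist_def)
  next
    case False
    then consider "x \<in> C" | "y \<in> C" using xy by blast
    then have "d_max d x y C \<le> d x y \<and> d x y \<le> d_min d x y C"
    proof cases
      case 1
      then show ?thesis
        using d_max_le[OF 1, of x y] abs_diff_le_d_min[OF assms(3) M 1] M by (simp add: commute)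
    next
      case 2
      then show ?thesis
        using d_max_le[OF 2, of x y] abs_diff_le_d_min[OF assms(3) M 2] M by simp
    qed
    moreover have "d x y \<le> d a x + d a y" "d a x \<le> d a y + d x y"
      using triangle[of x a y] triangle[of a y x] M assms(1) by (simp_all add: commute)
    ultimately show ?thesis by linarith
  qed
qed

text \<open>The distance from \<open>a\<close> is extended to new points as the largest function that is
  1-Lipschitz for the pseudometric \<open>d_min\<close>; for the largest function that is 1-Lipschitz for \<open>d\<close>,
  i.e. for free amalgamation, independence would fail.\<close>

lemma independent_extension:
  assumes M: "A \<subseteq> M" "B \<subseteq> M" "C \<subseteq> M" "P \<subseteq> M" and "finite P"
    and dense: "dense_of_card A d" "dense_of_card B d" "dense_of_card C d"
    and indep: "\<And>a. a \<in> A \<Longrightarrow> independent_dist C B (d a)"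
  shows "\<exists>f. \<forall>a\<in>A. f a \<in> M \<and> (\<forall>y\<in>B \<union> C. d (f a) y = d a y) \<and> (\<forall>a'\<in>A. d (f a) (f a') = d a a') \<and>
    independent_dist C (B \<union> C \<union> P) (d (f a))"
proof -
  define Y where "Y = B \<union> C \<union> P"
  define F where "F = (\<lambda>a y e. d a e + d_min d e y C)"
  define g where "g = (\<lambda>a y. glue 0 (B \<union> C) (F a y))"
  have YM: "y \<in> M" if "y \<in> Y" for y using that M by (auto simp: Y_def)
  have EM: "e \<in> M" if "e \<in> B \<union> C" for e using that M by auto
  have AM: "a \<in> M" if "a \<in> A" for a using that M by auto
  have nn: "0 \<le> F a y e" for a y e
    unfolding F_def using d_min_nonneg[OF M(3), of e y] by simp
  have ind: "d_max d x y C \<le> d a x + d a y" "d a x \<le> d a y + d_min d x y C"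
    if "a \<in> A" "x \<in> B \<union> C" "y \<in> B \<union> C" for a x y
    using independent_dist_Un[OF AM[OF that(1)] M(2,3) indep[OF that(1)]] that(2,3)
    by (auto simp: independent_dist_def)
  have g_ind: "independent_dist C Y (g a)" if a: "a \<in> A" for a
    unfolding independent_dist_def
  proof (intro ballI conjI)
    fix x y assume xy: "x \<in> Y" "y \<in> Y"
    show "d_max d x y C \<le> g a x + g a y"
      unfolding g_def
    proof (rule le_glue_add_glue)
      fix e e' assume e: "e \<in> B \<union> C" "e' \<in> B \<union> C"
      show "d_max d x y C \<le> F a x e + F a y e' + 2 * 0"
        using d_max_le_d_max_add_d_min[OF M(3) YM[OF xy(1)] EM[OF e(1)] YM[OF xy(2)] EM[OF e(2)]]
          ind(1)[OF a e] d_min_commute[of x e C] d_min_commute[of y e' C] by (simp add: F_def)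
    qed (use d_max_le_one nn in auto)
    show "g a x \<le> g a y + d_min d x y C"
      unfolding g_def
    proof (rule glue_le_add)
      show "F a x e \<le> F a y e + d_min d x y C" if "e \<in> B \<union> C" for e
        using d_min_triangle[OF M(3) EM[OF that] YM[OF xy(2)] YM[OF xy(1)]] d_min_commute[of x y C]
        by (simp add: F_def)
    qed (use nn d_min_nonneg[OF M(3)] in auto)
  qed
  have g_eq: "g a y = d a y" if a: "a \<in> A" and y: "y \<in> B \<union> C" for a y
  proof (rule antisym)
    have "d_min d y y C \<le> 0" using d_min_le_dist[OF M(3) EM[OF y] EM[OF y]] EM[OF y] by simp
    moreover have "g a y \<le> 0 + F a y y" unfolding g_def by (rule glue_le) (use nn y in auto)
    ultimately show "g a y \<le> d a y" by (simp add: F_def)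
    show "d a y \<le> g a y"
      unfolding g_def
    proof (rule le_glue)
      show "d a y \<le> 0 + F a y e" if "e \<in> B \<union> C" for e
        using ind(2)[OF a y that] d_min_commute[of e y C] by (simp add: F_def)
    qed (use le_one AM[OF a] EM[OF y] in auto)
  qed
  have "\<exists>f. \<forall>a\<in>A. f a \<in> M \<and> (\<forall>y\<in>Y. d (f a) y = g a y) \<and> (\<forall>a'\<in>A. d (f a) (f a') = d a a')"
  proof (rule realize)
    show "Y \<subseteq> M" using YM by blast
    have "dense_of_card P d" using \<open>finite P\<close> M(4) by (intro dense_of_card_countable countable_finite) auto
    then show "dense_of_card Y d" unfolding Y_def using dense by (intro dense_of_card_Un)
    show "dense_of_card A d" by (rule dense)
    show "d a a = 0" if "a \<in> A" for a using AM[OF that] by simp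
    show "d a b = d b a" for a b by (rule commute)
    show "d a b \<le> 1" if "a \<in> A" "b \<in> A" for a b using that AM le_one by auto
    show "d a c \<le> d a b + d b c" if "a \<in> A" "b \<in> A" "c \<in> A" for a b c using that AM triangle by auto
    show "katetov Y (\<lambda>x. x) (g a)" if a: "a \<in> A" for a
    proof -
      have "g a x \<le> g a y + d x y \<and> d x y \<le> g a x + g a y" if xy: "x \<in> Y" "y \<in> Y" for x y
        using g_ind[OF a] xy d_min_le_dist[OF M(3) YM[OF xy(1)] YM[OF xy(2)]]
          dist_le_d_max[OF M(3) YM[OF xy(1)] YM[OF xy(2)]]
        unfolding independent_dist_def by (meson add_left_mono order_trans)
      moreover have "g a x \<le> 1" for x unfolding g_def by (rule glue_le_one) (use nn in auto)
      ultimately show ?thesis using YM by (simp add: katetov_def)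
    qed
    show "g a y \<le> g b y + d a b \<and> d a b \<le> g a y + g b y" if a: "a \<in> A" "b \<in> A" and y: "y \<in> Y" for a b y
    proof
      show "g a y \<le> g b y + d a b"
        unfolding g_def
      proof (rule glue_le_add)
        show "F a y e \<le> F b y e + d a b" if "e \<in> B \<union> C" for e
          using triangle[OF AM[OF a(1)] AM[OF a(2)] EM[OF that]] by (simp add: F_def)
      qed (use nn in auto)
      show "d a b \<le> g a y + g b y"
        unfolding g_def
      proof (rule le_glue_add_glue)
        fix e e' assume e: "e \<in> B \<union> C" "e' \<in> B \<union> C"
        have "d a b \<le> d a e + d b e"
          using triangle[OF AM[OF a(1)] EM[OF e(1)] AM[OF a(2)]] by (simp add: commute)
        \<comment> \<open>Independence of \<open>b\<close> is used here in place of the triangle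
          inequality: a route through \<open>y\<close> bounds \<open>d_min d e e' C\<close>, whereas
          \<open>d e e'\<close> may exceed it.\<close>
        also have "d b e \<le> d b e' + d_min d e e' C" by (rule ind(2)[OF a(2) e])
        also have "d_min d e e' C \<le> d_min d e y C + d_min d e' y C"
          using d_min_triangle[OF M(3) EM[OF e(1)] YM[OF y] EM[OF e(2)]] d_min_commute[of y e' C] by simp
        finally show "d a b \<le> F a y e + F b y e' + 2 * 0" by (simp add: F_def)
      qed (use nn le_one AM a in auto)
    qed
  qed
  then obtain f where f: "\<And>a. a \<in> A \<Longrightarrow> f a \<in> M" "\<And>a y. a \<in> A \<Longrightarrow> y \<in> Y \<Longrightarrow> d (f a) y = g a y"
    "\<And>a a'. a \<in> A \<Longrightarrow> a' \<in> A \<Longrightarrow> d (f a) (f a') = d a a'" by blast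
  have "independent_dist C Y (d (f a))" if "a \<in> A" for a
    using g_ind[OF that] f(2)[OF that] by (simp add: independent_dist_def)
  moreover have "d (f a) y = d a y" if "a \<in> A" "y \<in> B \<union> C" for a y
  proof -
    have "y \<in> Y" using that(2) by (auto simp: Y_def)
    then show ?thesis using f(2)[OF that(1)] g_eq[OF that] by simp
  qed
  ultimately show ?thesis using f(1,3) unfolding Y_def by (intro exI[of _ f]) simp
qed

text \<open>In a sequence of copies of \<open>b\<close> whose cross distances \<open>d (b i ! p) (b j ! q)\<close>, \<open>i < j\<close>, hardly depend
  on \<open>i\<close> and \<open>j\<close>, the path \<open>b j ! p\<close>, \<open>b k ! q\<close>, \<open>b i ! p\<close>, \<open>b j ! q\<close> with \<open>i < j < k\<close> bounds these
  distances from below by a third of \<open>d (b ! p) (b ! q)\<close>.\<close>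

lemma homogeneous_subsequence:
  assumes C: "C \<subseteq> M" and b: "set b \<subseteq> M" and \<eta>: "0 < \<eta>"
    and bs: "\<And>l :: nat. set (bs l) \<subseteq> M" "\<And>l. length (bs l) = length b"
      "\<And>l. tp_list M d C (bs l) = tp_list M d C b"
  shows "\<exists>L. infinite L \<and> (\<forall>i\<in>L. \<forall>j\<in>L. \<forall>p<length b. \<forall>q<length b.
    d_min d (b ! p) (b ! q) C \<le> d (bs i ! p) (bs j ! q) + \<eta> \<and>
    d (bs i ! p) (bs j ! q) \<le> d_max d (b ! p) (b ! q) C)"
proof -
  let ?n = "length b"
  have bM: "b ! p \<in> M" "bs i ! p \<in> M" if "p < ?n" for p i
    using that b bs(1,2) by (metis nth_mem subsetD)+
  have bb: "d (bs i ! p) (bs i ! q) = d (b ! p) (b ! q)" if "p < ?n" "q < ?n" for i p q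
    using tp_list_eq_iff[OF C b bs(1,2)] bs(3) that by blast
  have bc: "d (bs i ! p) c = d (b ! p) c" if "p < ?n" "c \<in> C" for i p c
    using tp_list_eq_iff[OF C b bs(1,2)] bs(3) that by blast
  define D where "D = (\<lambda>i j (p, q). d (bs i ! p) (bs j ! q))"
  have "\<exists>L. infinite L \<and> (\<forall>i\<in>L. \<forall>j\<in>L. \<forall>i'\<in>L. \<forall>j'\<in>L. i < j \<longrightarrow> i' < j' \<longrightarrow>
    (\<forall>p\<in>{..<?n} \<times> {..<?n}. \<bar>D i j p - D i' j' p\<bar> \<le> \<eta>))"
    using \<eta> bM le_one by (intro ramsey_approximate) (auto simp: D_def)
  then obtain L where L: "infinite L" "\<And>i j i' j' p q. \<lbrakk>i \<in> L; j \<in> L; i' \<in> L; j' \<in> L; i < j; i' < j';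
     p < ?n; q < ?n\<rbrakk> \<Longrightarrow> \<bar>d (bs i ! p) (bs j ! q) - d (bs i' ! p) (bs j' ! q)\<bar> \<le> \<eta>"
    unfolding D_def by fastforce
  have third: "d (b ! p) (b ! q) \<le> 3 * (d (bs i ! p) (bs j ! q) + \<eta>)"
    if ij: "i \<in> L" "j \<in> L" "i < j" and pq: "p < ?n" "q < ?n" for i j p q
  proof -
    \<comment> \<open>The third copy lets every step of the path carry \<open>p\<close> in the
      earlier and \<open>q\<close> in the later copy, the only order in which the distances are
      almost constant.\<close>
    obtain k where k: "k \<in> L" "j < k" using L(1) infinite_nat_iff_unbounded by blast
    have "d (b ! p) (b ! q) = d (bs j ! p) (bs j ! q)" by (rule bb[OF pq, symmetric])
    moreover have "d (bs j ! p) (bs j ! q) \<le> d (bs j ! p) (bs k ! q) + d (bs k ! q) (bs j ! q)"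
      using bM pq by (intro triangle)
    moreover have "d (bs k ! q) (bs j ! q) \<le> d (bs k ! q) (bs i ! p) + d (bs i ! p) (bs j ! q)"
      using bM pq by (intro triangle)
    moreover have "d (bs k ! q) (bs i ! p) = d (bs i ! p) (bs k ! q)" by (rule commute)
    ultimately show ?thesis
      using L(2)[OF ij(2) k(1) ij(1,2) k(2) ij(3) pq] L(2)[OF ij(1) k(1) ij(1,2) less_trans[OF ij(3) k(2)] ij(3) pq]
      unfolding distrib_left by linarith
  qed
  have "d_min d (b ! p) (b ! q) C \<le> d (bs i ! p) (bs j ! q) + \<eta> \<and>
    d (bs i ! p) (bs j ! q) \<le> d_max d (b ! p) (b ! q) C"
    if ij: "i \<in> L" "j \<in> L" and pq: "p < ?n" "q < ?n" for i j p q
  proof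
    show "d (bs i ! p) (bs j ! q) \<le> d_max d (b ! p) (b ! q) C"
    proof (rule le_d_max)
      show "d (bs i ! p) (bs j ! q) \<le> d (b ! p) c + d (b ! q) c" if "c \<in> C" for c
        using triangle[OF bM(2)[OF pq(1)] subsetD[OF C that] bM(2)[OF pq(2)], of i j]
          bc[OF pq(1) that, of i] bc[OF pq(2) that, of j] commute[of c "bs j ! q"] by linarith
    qed (use le_one bM pq in auto)
    show "d_min d (b ! p) (b ! q) C \<le> d (bs i ! p) (bs j ! q) + \<eta>"
    proof (rule d_min_le[OF C])
      show "\<bar>d (b ! p) c - d (b ! q) c\<bar> \<le> d (bs i ! p) (bs j ! q) + \<eta>" if "c \<in> C" for c
        using abs_dist_diff_le[OF C bM(2)[OF pq(1)] bM(2)[OF pq(2)] subsetD[OF C that], of i j]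
          bc[OF pq(1) that, of i] bc[OF pq(2) that, of j] \<eta> by simp
      consider "i < j" | "j < i" | "i = j" by linarith
      then show "d (b ! p) (b ! q) \<le> 3 * (d (bs i ! p) (bs j ! q) + \<eta>)"
      proof cases
        case 1
        then show ?thesis using third ij pq by blast
      next
        case 2
        then show ?thesis using third[OF ij(2,1) 2 pq(2,1)] by (simp add: commute)
      next
        case 3
        then show ?thesis using bb[OF pq, of i] \<eta> nonneg[of "bs i ! p" "bs i ! q"] by simp
      qed
    qed
  qed
  then show ?thesis using L(1) by blast
qed

text \<open>Each \<open>f i\<close> is asked to keep towards \<open>k\<close> copies at once the
  distances it has to \<open>b\<close>. Independence makes this prescription Katetov up to
  \<open>\<eta>\<close>, the modulus of uniform continuity of \<open>\<phi>\<close> for the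
  \<open>\<epsilon>\<close> of the alleged dividing.\<close>

lemma not_divides_if_independent:
  fixes \<phi> :: "('i + nat) fm"
  assumes \<phi>: "(\<phi>, b) \<in> formulas_over M I" and C: "C \<subseteq> M" and f: "f \<in> I \<rightarrow> M"
    and ind: "\<And>i. i \<in> I \<Longrightarrow> independent_dist C (set b) (d (f i))"
    and 0: "pval M d (\<phi>, b) f = 0"
  shows "\<not> divides M d C I (\<phi>, b)"
proof
  assume "divides M d C I (\<phi>, b)"
  then obtain bs \<epsilon> k where \<epsilon>: "\<epsilon> > 0" and k: "k > 0"
    and bs: "\<And>l :: nat. set (bs l) \<subseteq> M" "\<And>l. length (bs l) = length b"
      "\<And>l. tp_list M d C (bs l) = tp_list M d C b"
    and incons: "\<And>K x. card K = k \<Longrightarrow> x \<in> I \<rightarrow> M \<Longrightarrow> \<exists>l\<in>K. \<not> pval M d (\<phi>, bs l) x \<le> \<epsilon>"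
    unfolding divides_def case_prod_conv by metis
  have \<phi>': "wf_fm \<phi>" "fv \<phi> \<subseteq> Inl ` I \<union> Inr ` {..<length b}" "set b \<subseteq> M"
    using \<phi> by (auto simp: formulas_over_def)
  let ?n = "length b"
  have bM: "b ! p \<in> M" "bs i ! p \<in> M" if "p < ?n" for p i
    using that \<phi>'(3) bs(1,2) by (metis nth_mem subsetD)+
  have bb: "d (bs i ! p) (bs i ! q) = d (b ! p) (b ! q)" if "p < ?n" "q < ?n" for i p q
    using tp_list_eq_iff[OF C \<phi>'(3) bs(1,2)] bs(3) that by blast
  obtain \<eta> where \<eta>: "0 < \<eta>" and unif: "\<And>\<sigma> \<sigma>'. (\<forall>x\<in>fv \<phi>. \<sigma> x \<in> M \<and> \<sigma>' x \<in> M) \<and>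
    (\<forall>x\<in>fv \<phi>. \<forall>y\<in>fv \<phi>. \<bar>d (\<sigma> x) (\<sigma> y) - d (\<sigma>' x) (\<sigma>' y)\<bar> \<le> \<eta>) \<Longrightarrow>
    \<bar>eval M d \<phi> \<sigma> - eval M d \<phi> \<sigma>'\<bar> \<le> \<epsilon>"
    using eval_uniformly_continuous[OF \<phi>'(1) \<epsilon>] by blast
  from homogeneous_subsequence[where bs=bs, OF C \<phi>'(3) \<eta> bs]
  obtain L where "infinite L" and L: "\<forall>i\<in>L. \<forall>j\<in>L. \<forall>p<?n. \<forall>q<?n.
    d_min d (b ! p) (b ! q) C \<le> d (bs i ! p) (bs j ! q) + \<eta> \<and>
    d (bs i ! p) (bs j ! q) \<le> d_max d (b ! p) (b ! q) C"
    by (elim exE conjE)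
  then obtain K where K: "K \<subseteq> L" "finite K" "card K = k"
    using infinite_arbitrarily_large by metis
  \<comment> \<open>Only the variables occurring in \<open>\<phi>\<close> move, so the tuple to be
    realized is finite however large \<open>I\<close> is.\<close>
  define J where "J = {i \<in> I. Inl i \<in> fv \<phi>}"
  have "finite J"
    using finite_vimageI[OF finite_fv[of \<phi>], of Inl] unfolding J_def
    by (rule rev_finite_subset) auto
  define E where "E = K \<times> {..<?n}"
  define z where "z = (\<lambda>(l, p). bs l ! p)"
  define t where "t = (\<lambda>i (l :: nat, p). d (f i) (b ! p))"
  define F where "F = (\<lambda>i y e. t i e + d (z e) y)"
  define g where "g = (\<lambda>i y. glue \<eta> E (F i y))"
  have fM: "f i \<in> M" if "i \<in> J" for i using f that by (auto simp: J_def)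
  have zM: "z e \<in> M" if "e \<in> E" for e using that bM by (auto simp: z_def E_def)
  have t01: "0 \<le> t i e \<and> t i e \<le> 1" if "i \<in> J" "e \<in> E" for i e
    using that bM fM le_one by (auto simp: t_def E_def)
  have tz: "t i e \<le> t i e' + d (z e) (z e') + \<eta>" "d (z e) (z e') \<le> t i e + t i e'"
    if i: "i \<in> J" and e: "e \<in> E" "e' \<in> E" for i e e'
  proof -
    obtain l p l' p' where ee: "e = (l, p)" "e' = (l', p')" by (metis surj_pair)
    have l: "l \<in> L" "l' \<in> L" "p < ?n" "p' < ?n" using e K(1) by (auto simp: ee E_def)
    have "i \<in> I" using i by (simp add: J_def)
    then have "d_max d (b ! p) (b ! p') C \<le> d (f i) (b ! p) + d (f i) (b ! p')"
      "d (f i) (b ! p) \<le> d (f i) (b ! p') + d_min d (b ! p) (b ! p') C"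
      using ind l(3,4) unfolding independent_dist_def by simp_all
    then show "t i e \<le> t i e' + d (z e) (z e') + \<eta>" "d (z e) (z e') \<le> t i e + t i e'"
      using L[rule_format, OF l] by (simp_all add: ee t_def z_def)
  qed
  have nn: "0 \<le> F i y e" if "i \<in> J" "e \<in> E" for i y e using t01[OF that] by (simp add: F_def)
  have kat: "katetov M (\<lambda>x. x) (g i)" and g: "\<And>e. e \<in> E \<Longrightarrow> \<bar>g i (z e) - t i e\<bar> \<le> \<eta>" if i: "i \<in> J" for i
    unfolding g_def F_def
    using katetov_correction[where z=z and t="t i" and I=E and \<eta>=\<eta>] \<eta> zM t01[OF i] tz(1)[OF i]
      order_trans[OF tz(2)[OF i], of _ _ "t i _ + t i _ + \<eta>"] by auto
  let ?Y = "z ` E"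
  have "\<exists>h. \<forall>i\<in>J. h i \<in> M \<and> (\<forall>y\<in>?Y. d (h i) y = g i y) \<and> (\<forall>j\<in>J. d (h i) (h j) = d (f i) (f j))"
  proof (rule realize)
    show "?Y \<subseteq> M" using zM by blast
    have "finite ?Y" using K(2) by (simp add: E_def)
    then show "dense_of_card ?Y d"
      using zM by (intro dense_of_card_countable countable_finite) auto
    show "dense_of_card J (\<lambda>i j. d (f i) (f j))"
      using \<open>finite J\<close> fM by (intro dense_of_card_countable countable_finite) auto
    show "katetov ?Y (\<lambda>x. x) (g i)" if "i \<in> J" for i
      using kat[OF that] zM by (auto simp: katetov_def)
    show "g i y \<le> g j y + d (f i) (f j) \<and> d (f i) (f j) \<le> g i y + g j y"
      if i: "i \<in> J" "j \<in> J" and y: "y \<in> ?Y" for i j y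
    proof
      have yM: "y \<in> M" using y zM by blast
      have tr: "t i e \<le> t j e + d (f i) (f j)" "d (f i) (f j) \<le> t i e + t j e" if "e \<in> E" for e
        using triangle[of "f i" "f j" "b ! snd e"] triangle[of "f i" "b ! snd e" "f j"] fM i bM that
        by (auto simp: t_def E_def commute)
      show "g i y \<le> g j y + d (f i) (f j)"
        unfolding g_def
      proof (rule glue_le_add)
        show "F i y e \<le> F j y e + d (f i) (f j)" if "e \<in> E" for e
          using tr(1)[OF that] by (simp add: F_def)
      qed (use nn i \<eta> in auto)
      show "d (f i) (f j) \<le> g i y + g j y"
        unfolding g_def
      proof (rule le_glue_add_glue)
        fix e e' assume e: "e \<in> E" "e' \<in> E"
        \<comment> \<open>The infima for \<open>i\<close> and \<open>j\<close> may be approached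
          along different \<open>e\<close> and \<open>e'\<close>. \<open>tz(1)\<close> compares
          them, and its error fits into the two shifts of \<open>glue\<close>.\<close>
        have "d (z e') (z e) \<le> d (z e) y + d (z e') y"
          using triangle[OF zM[OF e(2)] yM zM[OF e(1)]] by (simp add: commute)
        then show "d (f i) (f j) \<le> F i y e + F j y e' + 2 * \<eta>"
          using tr(2)[OF e(1)] tz(1)[OF i(2) e] \<eta> by (simp add: F_def commute)
      qed (use nn i \<eta> fM le_one in auto)
    qed
  qed (use fM le_one commute triangle in auto)
  then obtain h where h: "\<And>i. i \<in> J \<Longrightarrow> h i \<in> M" "\<And>i e. i \<in> J \<Longrightarrow> e \<in> E \<Longrightarrow> d (h i) (z e) = g i (z e)"
    "\<And>i j. i \<in> J \<Longrightarrow> j \<in> J \<Longrightarrow> d (h i) (h j) = d (f i) (f j)" by blast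
  define x where "x = (\<lambda>i. if i \<in> J then h i else f i)"
  have "x \<in> I \<rightarrow> M" using f h(1) by (auto simp: x_def)
  then obtain l where l: "l \<in> K" "\<not> pval M d (\<phi>, bs l) x \<le> \<epsilon>" using incons[OF K(3)] by blast
  let ?\<sigma> = "case_sum x (nth (bs l))" and ?\<sigma>' = "case_sum f (nth b)"
  have var: "(\<exists>i\<in>J. v = Inl i) \<or> (\<exists>p<?n. v = Inr p)" if "v \<in> fv \<phi>" for v
    using \<phi>'(2) that by (auto simp: J_def)
  have hb: "\<bar>d (h i) (bs l ! p) - d (f i) (b ! p)\<bar> \<le> \<eta>" if "i \<in> J" "p < ?n" for i p
    using g[OF that(1), of "(l, p)"] h(2)[OF that(1), of "(l, p)"] l(1) that(2)
    by (simp add: E_def z_def t_def)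
  then have bh: "\<bar>d (bs l ! p) (h i) - d (b ! p) (f i)\<bar> \<le> \<eta>" if "i \<in> J" "p < ?n" for i p
    using that by (simp add: commute)
  have "\<bar>eval M d \<phi> ?\<sigma> - eval M d \<phi> ?\<sigma>'\<bar> \<le> \<epsilon>"
  proof (rule unif, intro conjI ballI)
    fix v assume v: "v \<in> fv \<phi>"
    show "?\<sigma> v \<in> M" "?\<sigma>' v \<in> M" using var[OF v] h(1) fM bM by (auto simp: x_def)
    fix w assume w: "w \<in> fv \<phi>"
    show "\<bar>d (?\<sigma> v) (?\<sigma> w) - d (?\<sigma>' v) (?\<sigma>' w)\<bar> \<le> \<eta>"
      using var[OF v] var[OF w] h(3) hb bh bb \<eta> by (auto simp: x_def)
  qed
  then show False using l(2) 0 by (simp add: pval_def)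
qed

text \<open>The moved tuple still realizes the type, so \<open>\<phi>\<close> and with it some
  member of \<open>\<Psi>\<close> vanishes there. As the tuple is also independent from the
  parameters of that member, the member cannot divide.\<close>

lemma forking_independent_if_independent:
  assumes M: "A \<subseteq> M" "B \<subseteq> M" "C \<subseteq> M"
    and dense: "dense_of_card A d" "dense_of_card B d" "dense_of_card C d"
    and indep: "\<And>a. a \<in> A \<Longrightarrow> independent_dist C B (d a)"
  shows "forking_independent M d A C B"
  unfolding forking_independent_def
proof
  assume "type_forks M d C A (tp M d (B \<union> C) A (\<lambda>a. a))"
  then obtain \<phi> \<Psi> where real: "\<And>a. realizes M d A a (tp M d (B \<union> C) A (\<lambda>a. a)) \<Longrightarrow> pval M d \<phi> a = 0"
    and \<Psi>: "finite \<Psi>" "\<Psi> \<noteq> {}" "\<Psi> \<subseteq> formulas_over M A" "\<And>\<psi>. \<psi> \<in> \<Psi> \<Longrightarrow> divides M d C A \<psi>"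
      "\<And>a. a \<in> A \<rightarrow> M \<Longrightarrow> pval M d \<phi> a = 0 \<Longrightarrow> (MIN \<psi>\<in>\<Psi>. pval M d \<psi> a) = 0"
    unfolding type_forks_def forks_def by metis
  define P where "P = (\<Union>\<psi>\<in>\<Psi>. set (snd \<psi>))"
  have "set (snd \<psi>) \<subseteq> M" if "\<psi> \<in> \<Psi>" for \<psi>
    using subsetD[OF \<Psi>(3) that] by (auto simp: formulas_over_def)
  then have "finite P" "P \<subseteq> M" using \<Psi>(1) by (auto simp: P_def)
  then obtain f where f: "\<And>a. a \<in> A \<Longrightarrow> f a \<in> M" "\<And>a y. a \<in> A \<Longrightarrow> y \<in> B \<union> C \<Longrightarrow> d (f a) y = d a y"
    "\<And>a a'. a \<in> A \<Longrightarrow> a' \<in> A \<Longrightarrow> d (f a) (f a') = d a a'"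
    "\<And>a. a \<in> A \<Longrightarrow> independent_dist C (B \<union> C \<union> P) (d (f a))"
    using independent_extension[OF M, of P] dense indep by blast
  have fM: "f \<in> A \<rightarrow> M" using f(1) by blast
  have "pval M d \<psi> f = pval M d \<psi> (\<lambda>a. a)" if \<psi>: "\<psi> \<in> formulas_over (B \<union> C) A" for \<psi>
  proof -
    obtain \<theta> e where \<theta>: "\<psi> = (\<theta>, e)" "wf_fm \<theta>" "fv \<theta> \<subseteq> Inl ` A \<union> Inr ` {..<length e}" "set e \<subseteq> B \<union> C"
      using \<psi> by (cases \<psi>) (auto simp: formulas_over_def)
    have e: "e ! p \<in> B \<union> C" "e ! p \<in> M" if "p < length e" for p
      using that \<theta>(4) M by (meson nth_mem subsetD Un_least)+
    have fe: "d (f a) (e ! p) = d a (e ! p)" "d (e ! p) (f a) = d (e ! p) a" if "a \<in> A" "p < length e" for a p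
      using f(2)[OF that(1) e(1)[OF that(2)]] by (simp_all add: commute)
    show ?thesis
      unfolding \<theta>(1) pval_def case_prod_conv
    proof (rule eval_cong[OF \<theta>(2)])
      fix x assume x: "x \<in> fv \<theta>"
      show "case_sum f ((!) e) x \<in> M \<and> case_sum (\<lambda>a. a) ((!) e) x \<in> M"
        using subsetD[OF \<theta>(3) x] f(1) e(2) M(1) by auto
      fix y assume y: "y \<in> fv \<theta>"
      show "d (case_sum f ((!) e) x) (case_sum f ((!) e) y) =
        d (case_sum (\<lambda>a. a) ((!) e) x) (case_sum (\<lambda>a. a) ((!) e) y)"
        using subsetD[OF \<theta>(3) x] subsetD[OF \<theta>(3) y] f(3) fe by auto
    qed
  qed
  then have "realizes M d A f (tp M d (B \<union> C) A (\<lambda>a. a))"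
    using fM by (auto simp: realizes_def tp_def)
  then have "(MIN \<psi>\<in>\<Psi>. pval M d \<psi> f) = 0" using \<Psi>(5)[OF fM] real by blast
  moreover have "(MIN \<psi>\<in>\<Psi>. pval M d \<psi> f) \<in> (\<lambda>\<psi>. pval M d \<psi> f) ` \<Psi>"
    using \<Psi>(1,2) by (intro Min_in) auto
  ultimately obtain \<psi> where \<psi>: "\<psi> \<in> \<Psi>" "pval M d \<psi> f = 0" by force
  obtain \<theta> e where \<theta>: "\<psi> = (\<theta>, e)" by (cases \<psi>)
  have "set e \<subseteq> B \<union> C \<union> P" using \<psi>(1) by (force simp: P_def \<theta>)
  then have "\<not> divides M d C A (\<theta>, e)"
    using \<psi> \<Psi>(3) f(4) M(3) fM unfolding \<theta>
    by (intro not_divides_if_independent[where f=f]) (auto intro: independent_dist_subset)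
  then show False using \<Psi>(4)[OF \<psi>(1)] by (simp add: \<theta>)
qed

lemma dividing_independent_if_forking_independent:
  assumes "forking_independent M d A C B"
  shows "dividing_independent M d A C B"
proof -
  have "forks M d C A \<phi>" if "\<phi> \<in> formulas_over M A" "divides M d C A \<phi>" for \<phi>
    unfolding forks_def by (rule exI[of _ "{\<phi>}"]) (use that in auto)
  then show ?thesis
    using assms unfolding forking_independent_def dividing_independent_def type_forks_def type_divides_def
    by blast
qed

theorem independence_characterization:
  assumes M: "A \<subseteq> M" "B \<subseteq> M" "C \<subseteq> M"
    and dense: "dense_of_card A d" "dense_of_card B d" "dense_of_card C d"
  shows "(forking_independent M d A C B \<longleftrightarrow> dividing_independent M d A C B) \<and>
         (dividing_independent M d A C B \<longleftrightarrow>
           (\<forall>b1\<in>B. \<forall>b2\<in>B. d_max d b1 b2 (A \<union> C) = d_max d b1 b2 C \<and>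
                            d_min d b1 b2 (A \<union> C) = d_min d b1 b2 C))"
  unfolding amalgamation_distances_iff[OF M]
  using dividing_independent_if_forking_independent forking_independent_if_independent[OF M dense]
    independent_if_dividing_independent[OF M dense(3)]
  by blast

end

section \<open>Small sets\<close>

text \<open>The choice in \<open>density_character\<close> is meaningful because \<open>A\<close> is
  dense in itself and every nonempty family of cardinals has a least member.\<close>

lemma density_character_witness:
  assumes "Metric_space M d" "A \<subseteq> M"
  shows "\<exists>D. dense_subset M d A D \<and> density_character M d A = |D|"
proof -
  interpret Metric_space M d by fact
  let ?P = "\<lambda>D. dense_subset M d A D \<and> (\<forall>E. dense_subset M d A E \<longrightarrow> |D| \<le>o |E| )"
  have "dense_subset M d A A"
    using assms(2) by (simp add: dense_subset_def closure_of_subset)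
  then have "\<exists>r\<in>card_of ` {D. dense_subset M d A D}. \<forall>r'\<in>card_of ` {D. dense_subset M d A D}. r \<le>o r'"
    by (intro exists_minim_Well_order) (auto intro: card_of_Well_order)
  then have "\<exists>D. ?P D" by blast
  then have "?P (SOME D. ?P D)" by (rule someI_ex)
  then show ?thesis unfolding density_character_def by blast
qed

lemma (in urysohn_model) dense_of_card_if_density_character_le:
  assumes "A \<subseteq> M" "density_character M d A \<le>o \<kappa>"
  shows "dense_of_card A d"
proof -
  obtain D where D: "dense_subset M d A D" "density_character M d A = |D|"
    using density_character_witness[OF Metric_space_axioms assms(1)] by blast
  have "\<exists>y\<in>D. d x y < e" if "x \<in> A" "0 < e" for x e
  proof -
    have "x \<in> mtopology closure_of D" using D(1) that(1) unfolding dense_subset_def by blast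
    then obtain y where "y \<in> D" "y \<in> mball x e" using \<open>0 < e\<close> unfolding metric_closure_of by blast
    then show ?thesis by auto
  qed
  then show ?thesis
    using D assms(2) unfolding dense_of_card_def dense_subset_def by metis
qed

lemma urysohn_modelI:
  fixes M :: "'u set"
  assumes "urysohn_sphere X dX" "models M d (Th X dX)" "saturated M d (cardSuc \<kappa>)" "Cinfinite \<kappa>"
  shows "urysohn_model M d \<kappa>"
proof -
  interpret unit_metric M d
    using assms(2) by (simp add: models_def metric_structure_unit_metric)
  have "|D| <o cardSuc \<kappa>" if "|D| \<le>o \<kappa>" for D :: "'u set"
    using that assms(4) cardSuc_ordLeq_ordLess card_of_Card_order by blast
  then show ?thesis
    using assms(4) by unfold_locales (blast intro: saturated_extension[OF assms(1,2,3)])+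
qed

theorem theorem3p24:
  fixes X :: "'x set" and dX :: "'x \<Rightarrow> 'x \<Rightarrow> real"
    and U :: "'u set" and d :: "'u \<Rightarrow> 'u \<Rightarrow> real"
    and A B C :: "'u set"
  assumes "urysohn_sphere X dX"
    and "monster_model U d (Th X dX)"
    and "small U d A" and "small U d B" and "small U d C"
  shows "(forking_independent U d A C B \<longleftrightarrow> dividing_independent U d A C B) \<and>
         (dividing_independent U d A C B \<longleftrightarrow>
           (\<forall>b1\<in>B. \<forall>b2\<in>B. d_max d b1 b2 (A \<union> C) = d_max d b1 b2 C \<and>
                            d_min d b1 b2 (A \<union> C) = d_min d b1 b2 C))"
proof -
  have U: "models U d (Th X dX)" "saturated U d (cardSuc natLeq)"
    using assms(2) by (simp_all add: monster_model_def)
  have sub: "A \<subseteq> U" "B \<subseteq> U" "C \<subseteq> U"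
    and sat: "\<And>S. S \<in> {A, B, C} \<Longrightarrow> saturated U d (cardSuc (density_character U d S))"
    using assms(3-5) by (auto simp: small_def)
  have card: "Card_order (density_character U d S)" for S
    by (simp add: density_character_def card_of_Card_order)
  \<comment> \<open>One \<open>\<kappa>\<close> has to serve all three sets: the largest of their
    density characters, at whose successor the model is saturated.\<close>
  have "\<exists>r\<in>density_character U d ` {A, B, C}. \<forall>r'\<in>density_character U d ` {A, B, C}. r' \<le>o r"
  proof -
    have total: "density_character U d S \<le>o density_character U d T \<or>
        density_character U d T \<le>o density_character U d S" for S T
      using card unfolding card_order_on_def by (intro ordLeq_total) auto
    have refl: "density_character U d S \<le>o density_character U d S" for S
      using total by blast
    show ?thesis
      using total[of A B] total[of A C] total[of B C] refl
      by (simp only: image_insert image_empty ball_simps bex_simps) (blast intro: ordLeq_transitive)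
  qed
  then obtain S where S: "S \<in> {A, B, C}"
    "\<And>T. T \<in> {A, B, C} \<Longrightarrow> density_character U d T \<le>o density_character U d S" by blast
  show ?thesis
  \<comment> \<open>The locale asks for an infinite \<open>\<kappa>\<close>. If all three density
    characters are finite, the saturation in \<open>monster_model\<close> supplies
    \<open>natLeq\<close>.\<close>
  proof (cases "natLeq \<le>o density_character U d S")
    case True
    have "cinfinite (density_character U d S)"
      using True card cinfinite_mono natLeq_cinfinite by blast
    then interpret urysohn_model U d "density_character U d S"
      using card sat[OF S(1)] by (intro urysohn_modelI[OF assms(1) U(1)]) auto
    show ?thesis
      using S(2) sub by (intro independence_characterization dense_of_card_if_density_character_le) auto
  next
    case False
    interpret urysohn_model U d natLeq
      by (rule urysohn_modelI[OF assms(1) U natLeq_Cinfinite])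
    have "density_character U d S \<le>o natLeq"
      using False card natLeq_Card_order ordLeq_total unfolding card_order_on_def by blast
    then have "density_character U d T \<le>o natLeq" if "T \<in> {A, B, C}" for T
      using S(2)[OF that] ordLeq_transitive by blast
    then show ?thesis
      using sub by (intro independence_characterization dense_of_card_if_density_character_le) auto
  qed
qed

end
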